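(* Let $(\mathcal B;B_1,B_2)$ be a boundary triplet for $A_0^*$, where $A_0$ is a densely defined, skew-symmetric, closed linear operator on a Hilbert space $X$. Let $A$ be the restriction of $A_0^*$ to a linear subspace $\mathcal D\subset\mathrm{dom}(A_0^* )$ containing $\ker(B_1)\cap\ker(B_2)$. Define the subspace $\mathcal C:=\begin{bmatrix}B_1 \\ B_2\end{bmatrix}\mathcal D$ of $\mathcal B^2$. Then the following claims are true: 1. The domain of $A$ can be written $$\mathrm{dom}(A)=\mathcal D=\left\{d\in\mathrm{dom}(A_0^* )\;\middle|\;\begin{bmatrix}B_1d \\ B_2d\end{bmatrix}\in\mathcal C\right\}.$$ 2. The operator closure of $A$ is $A_0^*$ restricted to $$\widetilde{\mathcal D}=\left\{d\in\mathrm{dom}(A_0^* )\;\middle|\;\begin{bmatrix}B_1d \\ B_2d\end{bmatrix}\in\overline{\mathcal C}\right\},$$ where $\overline{\mathcal C}$ is the closure of $\mathcal C$ in $\mathcal B^2$. Moreover, $\widetilde{\mathcal D}$ is the closure of $\mathcal D$ in $\mathrm{dom}(A_0^* )$ endowed with the graph norm. Furthermore, $A$ is closed if and only if $\mathcal C$ is closed. 3. The adjoint $A^*$ is the restriction of $-A_0^*$ to $$\mathcal D'=\left\{d'\in\mathrm{dom}(A_0^* )\;\middle|\;\begin{bmatrix}B_1d' \\ B_2d'\end{bmatrix}\in\begin{bmatrix}0&I \\ I&0\end{bmatrix}\mathcal C^\perp\right\}.$$ 4. The operator $A$ is dissipative (respectively, maximal dissipative) if and only if $\mathcal C$ is a dissipative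 (respectively, maximal dissipative) relation in $\mathcal B$. Moreover, $A$ is maximal dissipative if and only if there exists a contraction $V$ on $\mathcal B$ such that $\mathcal C=\ker\begin{bmatrix}I+V&I-V\end{bmatrix}$. 5. The operator $A$ is skew-adjoint (i.e. $A^*=-A$) if and only if $\mathcal C=\begin{bmatrix}0&I \\ I&0\end{bmatrix}\mathcal C^\perp$. This holds if and only if $\mathcal C=\ker\begin{bmatrix}I+V&I-V\end{bmatrix}$ for some unitary operator $V$ on $\mathcal B$. It also holds that $A$ is accretive (respectively, maximal accretive) if and only if $\mathcal C$ is accretive (respectively, maximal accretive). Consequently, $A$ is skew-symmetric if and only if $\mathcal C$ is skew-symmetric.
   Context: Hilbert spaces are complex. Elements of $\mathcal B^2$ are written as columns; $\begin{bmatrix}B_1 \\ B_2\end{bmatrix}$ maps $x$ to $\begin{bmatrix}B_1x \\ B_2x\end{bmatrix}$, and $\begin{bmatrix}I+V&I-V\end{bmatrix}$ maps $\begin{bmatrix}f \\ e\end{bmatrix}\in\mathcal B^2$ to $(I+V)f+(I-V)e$. A contraction on $\mathcal B$ is an everywhere defined linear operator with norm at most $1$. $\mathcal C^\perp$ is the orthogonal complement in $\mathcal B^2$. Boundary triplet: let $A_0$ be a densely defined, skew-symmetric, closed linear operator on a Hilbert space $X$. A boundary triplet for $A_0^*$ is a triple $(\mathcal B;B_1,B_2)$ consisting of a Hilbert space $\mathcal B$ and two bounded linear operators $B_1,B_2:\mathrm{dom}(A_0^* )\to\mathcal B$ (where $\mathrm{dom}(A_0^* )$ carries the graph norm) such that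 $\begin{bmatrix}B_1 \\ B_2\end{bmatrix}\mathrm{dom}(A_0^* )=\mathcal B^2$ and, for all $x,\tilde x\in\mathrm{dom}(A_0^* )$, $$\langle A_0^*x,\tilde x\rangle_X+\langle x,A_0^*\tilde x\rangle_X=\langle B_1x,B_2\tilde x\rangle_{\mathcal B}+\langle B_2x,B_1\tilde x\rangle_{\mathcal B}.$$ Relations: a (linear) relation in a Hilbert space $H$ is a linear subspace $R\subset H^2$. It is dissipative if $\mathrm{Re}\langle r_1,r_2\rangle\le0$ for all $\begin{bmatrix}r_1 \\ r_2\end{bmatrix}\in R$; maximal dissipative if it is dissipative and has no proper extension to a dissipative relation in $H$; skew-symmetric if $\mathrm{Re}\langle r_1,r_2\rangle=0$ for all $\begin{bmatrix}r_1 \\ r_2\end{bmatrix}\in R$; (maximal) accretive if $\begin{bmatrix}I&0 \\ 0&-I\end{bmatrix}R$ is (maximal) dissipative. An operator $A:H\supset\mathrm{dom}(A)\to H$ is called (maximal) dissipative, (maximal) accretive, or skew-symmetric if its graph $\left\{\begin{bmatrix}x \\ Ax\end{bmatrix}\mid x\in\mathrm{dom}(A)\right\}$ has the corresponding property as a relation in $H$. *)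

theory Defs
  imports "HOL-Analysis.Analysis"
begin

subsection \<open>Complex Hilbert spaces\<close>

class scaleC =
  fixes scaleC :: "complex \<Rightarrow> 'a \<Rightarrow> 'a"  (infixr "*\<^sub>C" 75)

class complex_vector = real_vector + scaleC +
  assumes scaleC_add_right: "a *\<^sub>C (x + y) = a *\<^sub>C x + a *\<^sub>C y"
    and scaleC_add_left: "(a + b) *\<^sub>C x = a *\<^sub>C x + b *\<^sub>C x"
    and scaleC_scaleC: "a *\<^sub>C (b *\<^sub>C x) = (a * b) *\<^sub>C x"
    and scaleC_one: "1 *\<^sub>C x = x"
    and scaleR_scaleC: "r *\<^sub>R x = complex_of_real r *\<^sub>C x"

global_interpretation complex_vector: vector_space "scaleC :: complex \<Rightarrow> 'a \<Rightarrow> 'a::complex_vector"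
  by unfold_locales (simp_all add: scaleC_add_right scaleC_add_left scaleC_scaleC scaleC_one)

abbreviation csubspace :: "'a::complex_vector set \<Rightarrow> bool" where
  "csubspace \<equiv> complex_vector.subspace"

abbreviation clinear :: "('a::complex_vector \<Rightarrow> 'b::complex_vector) \<Rightarrow> bool" where
  "clinear \<equiv> Vector_Spaces.linear scaleC scaleC"

text \<open>
  The inner product is linear in its first argument.  The class builds on \<^class>\<open>real_inner\<close> by
  requiring the real inner product to be the real part of the complex one, so that the norm and
  the topology are the usual ones (see \<open>cinner_self\<close>); positive definiteness is inherited.
\<close>

class complex_inner = complex_vector + real_inner +
  fixes cinner :: "'a \<Rightarrow> 'a \<Rightarrow> complex"
  assumes cinner_commute: "cinner x y = cnj (cinner y x)"
    and cinner_add_left: "cinner (x + y) z = cinner x z + cinner y z"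
    and cinner_scaleC_left: "cinner (a *\<^sub>C x) y = a * cinner x y"
    and inner_eq_Re_cinner: "inner x y = Re (cinner x y)"

lemma cinner_self: "cinner x x = complex_of_real ((norm x)\<^sup>2)" for x :: "'a::complex_inner"
proof (rule complex_eqI)
  show "Re (cinner x x) = Re (complex_of_real ((norm x)\<^sup>2))"
    by (simp add: inner_eq_Re_cinner[symmetric] power2_norm_eq_inner del: of_real_power)
  have "Im (cinner x x) = - Im (cinner x x)"
    using arg_cong[OF cinner_commute[of x x], of Im] by simp
  then show "Im (cinner x x) = Im (complex_of_real ((norm x)\<^sup>2))"
    by (simp del: of_real_power)
qed

class chilbert_space = complex_inner + complete_space

instantiation complex :: chilbert_space
begin

definition scaleC_complex :: "complex \<Rightarrow> complex \<Rightarrow> complex" where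
  "scaleC_complex a x = a * x"

definition cinner_complex :: "complex \<Rightarrow> complex \<Rightarrow> complex" where
  "cinner_complex x y = x * cnj y"

instance
  by standard
    (simp_all add: scaleC_complex_def cinner_complex_def inner_complex_def algebra_simps scaleR_conv_of_real)

end

text \<open>The direct sum of two Hilbert spaces; norm and topology are those of the product type.\<close>

instantiation prod :: (complex_vector, complex_vector) complex_vector
begin

definition scaleC_prod :: "complex \<Rightarrow> 'a \<times> 'b \<Rightarrow> 'a \<times> 'b" where
  "scaleC_prod a p = (a *\<^sub>C fst p, a *\<^sub>C snd p)"

instance
  by standard
    (simp_all add: scaleC_prod_def scaleR_prod_def scaleC_add_right scaleC_add_left scaleC_scaleC
      scaleC_one scaleR_scaleC)

end

instantiation prod :: (complex_inner, complex_inner) complex_inner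
begin

definition cinner_prod :: "'a \<times> 'b \<Rightarrow> 'a \<times> 'b \<Rightarrow> complex" where
  "cinner_prod p q = cinner (fst p) (fst q) + cinner (snd p) (snd q)"

instance
proof
  fix x y z :: "'a \<times> 'b" and a :: complex
  show "cinner x y = cnj (cinner y x)"
    unfolding cinner_prod_def complex_cnj_add by (metis cinner_commute)
qed (simp_all add: cinner_prod_def scaleC_prod_def cinner_add_left cinner_scaleC_left
      inner_prod_def inner_eq_Re_cinner algebra_simps)

end

instance prod :: (chilbert_space, chilbert_space) chilbert_space ..

definition corthogonal_complement :: "'a::complex_inner set \<Rightarrow> 'a set" where
  "corthogonal_complement S = {y. \<forall>x\<in>S. cinner x y = 0}"


subsection \<open>Linear relations\<close>

definition dissipative_relation :: "('h::complex_inner \<times> 'h) set \<Rightarrow> bool" where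
  "dissipative_relation R \<longleftrightarrow> csubspace R \<and> (\<forall>(r1, r2)\<in>R. Re (cinner r1 r2) \<le> 0)"

definition maximal_dissipative_relation :: "('h::complex_inner \<times> 'h) set \<Rightarrow> bool" where
  "maximal_dissipative_relation R \<longleftrightarrow>
     dissipative_relation R \<and> (\<forall>S. dissipative_relation S \<and> R \<subseteq> S \<longrightarrow> S = R)"

definition skew_symmetric_relation :: "('h::complex_inner \<times> 'h) set \<Rightarrow> bool" where
  "skew_symmetric_relation R \<longleftrightarrow> csubspace R \<and> (\<forall>(r1, r2)\<in>R. Re (cinner r1 r2) = 0)"

definition accretive_relation :: "('h::complex_inner \<times> 'h) set \<Rightarrow> bool" where
  "accretive_relation R \<longleftrightarrow> dissipative_relation ((\<lambda>(r1, r2). (r1, - r2)) ` R)"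

definition maximal_accretive_relation :: "('h::complex_inner \<times> 'h) set \<Rightarrow> bool" where
  "maximal_accretive_relation R \<longleftrightarrow> maximal_dissipative_relation ((\<lambda>(r1, r2). (r1, - r2)) ` R)"


subsection \<open>Unbounded operators\<close>

text \<open>
  A partially defined operator \<open>A : H \<supset> dom(A) \<rightarrow> H\<close> is a partial map \<open>A :: 'h \<rightharpoonup> 'h\<close>, whose value
  at \<open>x \<in> dom A\<close> is \<open>the (A x)\<close>.  Equality of partial maps is equality of domains and values,
  \<^const>\<open>Map.graph\<close> is the graph, and \<open>A |` D\<close> is the restriction to \<open>D\<close>.
\<close>

definition clinear_on :: "'a::complex_vector set \<Rightarrow> ('a \<Rightarrow> 'b::complex_vector) \<Rightarrow> bool" where
  "clinear_on S f \<longleftrightarrow> csubspace S \<and>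
     (\<forall>x\<in>S. \<forall>y\<in>S. f (x + y) = f x + f y) \<and> (\<forall>c. \<forall>x\<in>S. f (c *\<^sub>C x) = c *\<^sub>C f x)"

definition linear_operator :: "('h::complex_vector \<rightharpoonup> 'h) \<Rightarrow> bool" where
  "linear_operator A \<longleftrightarrow> clinear_on (dom A) (\<lambda>x. the (A x))"

definition densely_defined :: "('h::complex_inner \<rightharpoonup> 'h) \<Rightarrow> bool" where
  "densely_defined A \<longleftrightarrow> closure (dom A) = UNIV"

definition closed_operator :: "('h::complex_inner \<rightharpoonup> 'h) \<Rightarrow> bool" where
  "closed_operator A \<longleftrightarrow> closed (Map.graph A)"

text \<open>\<open>A\<close> is closable and its closure is \<open>B\<close>.\<close>

definition operator_closure_is :: "('h::complex_inner \<rightharpoonup> 'h) \<Rightarrow> ('h \<rightharpoonup> 'h) \<Rightarrow> bool" where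
  "operator_closure_is A B \<longleftrightarrow> Map.graph B = closure (Map.graph A)"

text \<open>
  The adjoint is meaningful only for densely defined \<open>A\<close>, for which the element \<open>z\<close> below is
  unique.
\<close>

definition adjoint_op :: "('h::complex_inner \<rightharpoonup> 'h) \<Rightarrow> ('h \<rightharpoonup> 'h)" where
  "adjoint_op A y =
     (if \<exists>z. \<forall>x\<in>dom A. cinner (the (A x)) y = cinner x z
      then Some (THE z. \<forall>x\<in>dom A. cinner (the (A x)) y = cinner x z)
      else None)"

definition uminus_op :: "('h::complex_vector \<rightharpoonup> 'h) \<Rightarrow> ('h \<rightharpoonup> 'h)" where
  "uminus_op A = (\<lambda>x. map_option uminus (A x))"

definition dissipative_op :: "('h::complex_inner \<rightharpoonup> 'h) \<Rightarrow> bool" where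
  "dissipative_op A \<longleftrightarrow> dissipative_relation (Map.graph A)"

definition maximal_dissipative_op :: "('h::complex_inner \<rightharpoonup> 'h) \<Rightarrow> bool" where
  "maximal_dissipative_op A \<longleftrightarrow> maximal_dissipative_relation (Map.graph A)"

definition accretive_op :: "('h::complex_inner \<rightharpoonup> 'h) \<Rightarrow> bool" where
  "accretive_op A \<longleftrightarrow> accretive_relation (Map.graph A)"

definition maximal_accretive_op :: "('h::complex_inner \<rightharpoonup> 'h) \<Rightarrow> bool" where
  "maximal_accretive_op A \<longleftrightarrow> maximal_accretive_relation (Map.graph A)"

definition skew_symmetric_op :: "('h::complex_inner \<rightharpoonup> 'h) \<Rightarrow> bool" where
  "skew_symmetric_op A \<longleftrightarrow> skew_symmetric_relation (Map.graph A)"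

definition skew_adjoint_op :: "('h::complex_inner \<rightharpoonup> 'h) \<Rightarrow> bool" where
  "skew_adjoint_op A \<longleftrightarrow> adjoint_op A = uminus_op A"

text \<open>The norm of \<open>H \<times> H\<close> makes this \<open>sqrt (\<parallel>x\<parallel>\<^sup>2 + \<parallel>T x\<parallel>\<^sup>2)\<close>; it is used for \<open>x \<in> dom T\<close> only.\<close>

definition graph_norm :: "('h::complex_inner \<rightharpoonup> 'h) \<Rightarrow> 'h \<Rightarrow> real" where
  "graph_norm T x = norm (x, the (T x))"

text \<open>The topology of the normed space \<open>dom T\<close> with the graph norm, for a linear operator \<open>T\<close>.\<close>

definition graph_topology :: "('h::complex_inner \<rightharpoonup> 'h) \<Rightarrow> 'h topology" where
  "graph_topology T = Metric_space.mtopology (dom T) (\<lambda>x y. graph_norm T (x - y))"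


subsection \<open>Bounded operators on a Hilbert space\<close>

definition contraction :: "('b::complex_inner \<Rightarrow> 'b) \<Rightarrow> bool" where
  "contraction V \<longleftrightarrow> clinear V \<and> bounded_linear V \<and> onorm V \<le> 1"

definition unitary :: "('b::complex_inner \<Rightarrow> 'b) \<Rightarrow> bool" where
  "unitary V \<longleftrightarrow> clinear V \<and> surj V \<and> (\<forall>x y. cinner (V x) (V y) = cinner x y)"

text \<open>The kernel of the row operator \<open>[I + V, I - V]\<close>.\<close>

definition ker_row :: "('b::complex_vector \<Rightarrow> 'b) \<Rightarrow> ('b \<times> 'b) set" where
  "ker_row V = {(f, e). (f + V f) + (e - V e) = 0}"


subsection \<open>Boundary triplets\<close>

text \<open>
  \<open>(\<B>; B1, B2)\<close> is a boundary triplet for the adjoint of \<open>A0\<close>.  The space \<open>\<B>\<close> is the type \<open>'b\<close>;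
  only the values of \<open>B1\<close> and \<open>B2\<close> on the domain of the adjoint matter.
\<close>

definition boundary_triplet ::
    "('x::chilbert_space \<rightharpoonup> 'x) \<Rightarrow> ('x \<Rightarrow> 'b::chilbert_space) \<Rightarrow> ('x \<Rightarrow> 'b) \<Rightarrow> bool" where
  "boundary_triplet A0 B1 B2 \<longleftrightarrow>
     (let T = adjoint_op A0 in
      clinear_on (dom T) B1 \<and> (\<exists>K. \<forall>x\<in>dom T. norm (B1 x) \<le> K * graph_norm T x) \<and>
      clinear_on (dom T) B2 \<and> (\<exists>K. \<forall>x\<in>dom T. norm (B2 x) \<le> K * graph_norm T x) \<and>
      (\<lambda>x. (B1 x, B2 x)) ` dom T = UNIV \<and>
      (\<forall>x\<in>dom T. \<forall>y\<in>dom T.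
         cinner (the (T x)) y + cinner x (the (T y)) = cinner (B1 x) (B2 y) + cinner (B2 x) (B1 y)))"

end

theory Submission
  imports Defs
begin

text \<open>
  Write \<open>T\<close> for the adjoint of \<open>A\<^sub>0\<close> and \<open>B x = (B1 x, B2 x)\<close>.  Skew-symmetry and the surjectivity of \<open>B\<close>
  force \<open>dom A\<^sub>0\<close> into the kernel of \<open>B\<close>.  Hence \<open>T\<close> is, up to sign, also the adjoint of its own
  restriction to this kernel.  The proof rests on this property and Green's identity; the locale
  \<open>green_triple\<close> collects them, and \<open>boundary_triplet_green_triple\<close> derives them from a boundary triplet.

  Green's identity identifies the orthogonal complement of the graph of a restriction of \<open>T\<close> with the
  graph, coordinates exchanged, of the restriction to the elements \<open>v\<close> whose swapped boundary values are
  orthogonal to \<open>C\<close> (\<open>mem_orthogonal_graph_iff\<close>).  Read as a formula, this is the adjoint of \<open>A\<close>; applied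
  a second time it is the double complement of the graph, that is, the closure of \<open>A\<close>
  (\<open>closure_graph_on\<close>).  So closures of graphs correspond to closures of boundary spaces by algebra alone,
  given that a closed subspace is its own double complement.

  Dissipativity passes between \<open>A\<close> and \<open>C\<close> because \<open>Re \<langle>x, T x\<rangle> = Re \<langle>B1 x, B2 x\<rangle>\<close>.  For maximality one
  must compare with arbitrary dissipative relations in \<open>X\<close>.  These are restrictions of \<open>T\<close> as soon as they
  extend the restriction of \<open>T\<close> to the kernel of \<open>B\<close>: the members of the latter are neutral for the
  dissipativity form, and a vector of a nonpositive subspace is orthogonal to the neutral ones
  (\<open>dissipative_relation_neutral_orthogonal\<close>, \<open>dissipative_extension_is_graph\<close>).

  The remaining claims concern the relation \<open>C\<close> alone.  In the coordinates \<open>p = f - e\<close>, \<open>q = f + e\<close> a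
  dissipative relation is the graph of a contraction \<open>p \<mapsto> q\<close> on a subspace.  It is maximal exactly when
  this subspace is the whole space, because a contraction on a closed subspace extends by zero to its
  orthogonal complement.  A relation equal to its swapped complement is neutral and maximal dissipative,
  and so is its reflection \<open>(f, e) \<mapsto> (f, - e)\<close>, which exchanges \<open>p\<close> and \<open>q\<close>; this makes the contraction
  unitary.
\<close>

section \<open>Orthogonal complements\<close>

lemma cinner_add_right: "cinner x (y + z) = cinner x y + cinner x z"
  by (metis cinner_add_left cinner_commute complex_cnj_add)

lemma cinner_scaleC_right: "cinner x (a *\<^sub>C y) = cnj a * cinner x y"
  by (metis cinner_commute cinner_scaleC_left complex_cnj_mult)

lemma cinner_minus_left [simp]: "cinner (- x) y = - cinner x y"
  by (metis (no_types, opaque_lifting) add.commute add_cancel_right_left cinner_add_left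
      add_minus_cancel eq_neg_iff_add_eq_0)

lemma cinner_minus_right [simp]: "cinner x (- y) = - cinner x y"
  by (metis cinner_minus_left cinner_commute complex_cnj_minus)

lemma cinner_zero_left [simp]: "cinner 0 y = 0"
  using cinner_add_left[of 0 0 y] by simp

lemma cinner_zero_right [simp]: "cinner x 0 = 0"
  using cinner_add_right[of x 0 0] by simp

lemma cinner_diff_left: "cinner (x - y) z = cinner x z - cinner y z"
  using cinner_add_left[of x "- y" z] by simp

lemma cinner_diff_right: "cinner x (y - z) = cinner x y - cinner x z"
  using cinner_add_right[of x y "- z"] by simp

lemma cinner_eq_0_swap: "cinner x y = 0 \<longleftrightarrow> cinner y x = 0"
  by (metis cinner_commute complex_cnj_zero_iff)

lemma cinner_self_eq_0: "cinner x x = 0 \<longleftrightarrow> x = 0" for x :: "'a::complex_inner"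
  by (simp add: cinner_self)

lemma csubspace_imp_subspace: "csubspace M \<Longrightarrow> subspace M"
  unfolding subspace_def complex_vector.subspace_def by (simp add: scaleR_scaleC)

lemma csubspace_corthogonal_complement: "csubspace (corthogonal_complement S)"
  unfolding complex_vector.subspace_def corthogonal_complement_def
  by (simp add: cinner_add_right cinner_scaleC_right)

text \<open>
  The imaginary part of \<open>cinner x y\<close> is the real part for \<open>\<i> *\<^sub>C x\<close>, up to sign.  Hence the real
  geometry of the space decides complex orthogonality to a complex subspace.
\<close>

lemma corthogonal_complement_eq_inner:
  assumes "csubspace M"
  shows "corthogonal_complement M = {y. \<forall>x\<in>M. inner x y = 0}"
proof -
  have "cinner x y = 0" if "x \<in> M" and y: "\<forall>x\<in>M. inner x y = 0" for x y
  proof -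
    have "\<i> *\<^sub>C x \<in> M"
      using assms that(1) by (rule complex_vector.subspace_scale)
    then have "inner (\<i> *\<^sub>C x) y = 0"
      using y by blast
    then have "Im (cinner x y) = 0"
      by (simp add: inner_eq_Re_cinner cinner_scaleC_left)
    moreover have "Re (cinner x y) = 0"
      using y that(1) by (simp add: inner_eq_Re_cinner)
    ultimately show ?thesis
      by (simp add: complex_eq_iff)
  qed
  then show ?thesis
    by (auto simp: corthogonal_complement_def inner_eq_Re_cinner)
qed

lemma closed_corthogonal_complement:
  assumes "csubspace M"
  shows "closed (corthogonal_complement M)"
proof -
  have "corthogonal_complement M = (\<Inter>x\<in>M. {y. inner x y = 0})"
    by (auto simp: corthogonal_complement_eq_inner[OF assms])
  moreover have "closed {y. inner x y = 0}" for x :: 'a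
    by (intro closed_Collect_eq continuous_intros)
  ultimately show ?thesis
    by auto
qed

text \<open>
  A minimizing sequence of members of \<open>M\<close> is Cauchy by the parallelogram identity.  Its limit lies
  only in the closure, but comparing it with the translates by members of \<open>M\<close> is enough to make
  \<open>x - y\<close> orthogonal to \<open>M\<close>.
\<close>

lemma subspace_nearest_point_exists:
  fixes M :: "'a::{real_inner,complete_space} set"
  assumes M: "subspace M"
  shows "\<exists>y\<in>closure M. \<forall>m\<in>M. norm (x - y) \<le> norm (x - y - m)"
proof -
  define d where "d = (INF m\<in>M. norm (x - m))"
  have "M \<noteq> {}"
    using subspace_0[OF M] by auto
  have bdd: "bdd_below ((\<lambda>m. norm (x - m)) ` M)"
    by (intro bdd_belowI[of _ 0]) auto
  have d_le: "d \<le> norm (x - m)" if "m \<in> M" for m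
    unfolding d_def using bdd that by (rule cINF_lower)
  have "0 \<le> d"
    unfolding d_def using \<open>M \<noteq> {}\<close> by (intro cINF_greatest) auto
  have "\<exists>m\<in>M. norm (x - m) < d + inverse (real (Suc n))" for n
  proof -
    have "d < d + inverse (real (Suc n))"
      by simp
    then show ?thesis
      unfolding d_def using cINF_less_iff[OF \<open>M \<noteq> {}\<close> bdd] by metis
  qed
  then obtain s where s: "\<And>n. s n \<in> M" "\<And>n. norm (x - s n) < d + inverse (real (Suc n))"
    by metis
  have s_lim: "(\<lambda>n. norm (x - s n)) \<longlonglongrightarrow> d"
  proof (rule tendsto_sandwich[where f = "\<lambda>n. d"])
    show "(\<lambda>n. d + inverse (real (Suc n))) \<longlonglongrightarrow> d"
      using tendsto_add[OF tendsto_const[of d] LIMSEQ_inverse_real_of_nat] by simp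
    show "\<forall>\<^sub>F n in sequentially. d \<le> norm (x - s n)"
      using d_le s(1) by simp
    show "\<forall>\<^sub>F n in sequentially. norm (x - s n) \<le> d + inverse (real (Suc n))"
      using s(2) by (auto intro: always_eventually less_imp_le)
  qed simp
  \<comment> \<open>The midpoint of two members of \<open>M\<close> is at distance at least \<open>d\<close> from \<open>x\<close>, so the parallelogram
    identity leaves little room between two almost nearest members.\<close>
  have dist_s: "(norm (s m - s n))\<^sup>2 \<le> 2 * (norm (x - s m))\<^sup>2 + 2 * (norm (x - s n))\<^sup>2 - 4 * d\<^sup>2" for m n
  proof -
    have "(1/2) *\<^sub>R (s m + s n) \<in> M"
      using M s(1) by (intro subspace_scale subspace_add)
    then have "d\<^sup>2 \<le> (norm (x - (1/2) *\<^sub>R (s m + s n)))\<^sup>2"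
      using d_le \<open>0 \<le> d\<close> by (intro power_mono)
    moreover have "4 * (norm (x - (1/2) *\<^sub>R (s m + s n)))\<^sup>2 + (norm (s m - s n))\<^sup>2
        = 2 * (norm (x - s m))\<^sup>2 + 2 * (norm (x - s n))\<^sup>2"
      unfolding power2_norm_eq_inner by (simp add: inner_commute algebra_simps)
    ultimately show ?thesis
      by simp
  qed
  have "Cauchy s"
  proof (rule CauchyI)
    fix e :: real assume "0 < e"
    have "(\<lambda>n. (norm (x - s n))\<^sup>2) \<longlonglongrightarrow> d\<^sup>2"
      by (intro tendsto_intros s_lim)
    moreover have "d\<^sup>2 < d\<^sup>2 + e\<^sup>2 / 4"
      using \<open>0 < e\<close> by simp
    ultimately have "\<forall>\<^sub>F n in sequentially. (norm (x - s n))\<^sup>2 < d\<^sup>2 + e\<^sup>2 / 4"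
      by (rule order_tendstoD(2))
    then obtain N where N: "\<And>n. N \<le> n \<Longrightarrow> (norm (x - s n))\<^sup>2 < d\<^sup>2 + e\<^sup>2 / 4"
      by (auto simp: eventually_sequentially)
    have "norm (s m - s n) < e" if "N \<le> m" "N \<le> n" for m n
    proof -
      have "(norm (s m - s n))\<^sup>2 < e\<^sup>2"
        using dist_s[of m n] N[OF that(1)] N[OF that(2)] by simp
      then show ?thesis
        using \<open>0 < e\<close> by (simp add: power_less_imp_less_base)
    qed
    then show "\<exists>N. \<forall>m\<ge>N. \<forall>n\<ge>N. norm (s m - s n) < e"
      by blast
  qed
  then obtain y where y: "s \<longlonglongrightarrow> y"
    using Cauchy_convergent convergent_def by blast
  have "y \<in> closure M"
    using y s(1) closure_sequential by blast
  moreover have "norm (x - y) \<le> norm (x - y - m)" if "m \<in> M" for m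
  proof -
    have "norm (x - y) = d"
      using tendsto_norm[OF tendsto_diff[OF tendsto_const y]] s_lim LIMSEQ_unique by blast
    moreover have "d \<le> norm (x - y - m)"
    proof (rule Lim_bounded2)
      show "(\<lambda>n. norm (x - s n - m)) \<longlonglongrightarrow> norm (x - y - m)"
        by (intro tendsto_intros y)
      show "\<forall>n\<ge>0. d \<le> norm (x - s n - m)"
        using d_le subspace_add[OF M s(1) that] by (simp add: diff_diff_eq)
    qed
    ultimately show ?thesis
      by simp
  qed
  ultimately show ?thesis
    by blast
qed

lemma orthogonal_if_no_nearer:
  fixes z m :: "'a::real_inner"
  assumes "\<And>r. norm z \<le> norm (z - r *\<^sub>R m)"
  shows "inner m z = 0"
proof (cases "m = 0")
  case False
  \<comment> \<open>This multiple of \<open>m\<close> is the nearest one to \<open>z\<close>.\<close>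
  define r where "r = inner m z / inner m m"
  have "(norm z)\<^sup>2 \<le> (norm (z - r *\<^sub>R m))\<^sup>2"
    using assms by (intro power_mono) auto
  also have "\<dots> = (norm z)\<^sup>2 - (inner m z)\<^sup>2 / inner m m"
    unfolding power2_norm_eq_inner r_def using False
    by (simp add: inner_commute algebra_simps power2_eq_square)
  finally have "(inner m z)\<^sup>2 \<le> 0"
    using False by (simp add: divide_le_0_iff) (metis inner_gt_zero_iff not_less inner_ge_zero le_less)
  then show ?thesis
    by simp
qed simp

text \<open>
  This is how completeness enters most of what follows: membership in a closure becomes a family of
  equations, which Green's identity can transport between the graph and the boundary space.
\<close>

lemma closure_eq_corthogonal_complement_twice:
  fixes M :: "'a::chilbert_space set"
  assumes M: "csubspace M"
  shows "closure M = corthogonal_complement (corthogonal_complement M)"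
proof
  show sub: "closure M \<subseteq> corthogonal_complement (corthogonal_complement M)"
  proof (rule closure_minimal)
    show "M \<subseteq> corthogonal_complement (corthogonal_complement M)"
      by (auto simp: corthogonal_complement_def cinner_eq_0_swap)
  qed (intro closed_corthogonal_complement csubspace_corthogonal_complement)
  show "corthogonal_complement (corthogonal_complement M) \<subseteq> closure M"
  proof
    fix x assume x: "x \<in> corthogonal_complement (corthogonal_complement M)"
    have "subspace M"
      using M by (rule csubspace_imp_subspace)
    then obtain y where y: "y \<in> closure M" "\<And>m. m \<in> M \<Longrightarrow> norm (x - y) \<le> norm (x - y - m)"
      using subspace_nearest_point_exists by blast
    have "inner m (x - y) = 0" if "m \<in> M" for m
      using y(2) subspace_scale[OF \<open>subspace M\<close> that] by (intro orthogonal_if_no_nearer) blast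
    then have "x - y \<in> corthogonal_complement M"
      by (simp add: corthogonal_complement_eq_inner[OF M])
    moreover have "x - y \<in> corthogonal_complement (corthogonal_complement M)"
      using x y(1) sub csubspace_corthogonal_complement complex_vector.subspace_diff by blast
    ultimately have "cinner (x - y) (x - y) = 0"
      unfolding corthogonal_complement_def[of "corthogonal_complement M"] by blast
    then show "x \<in> closure M"
      using y(1) by (simp add: cinner_self_eq_0)
  qed
qed

section \<open>Dissipative relations and the Cayley transform\<close>

lemma csubspace_pairI:
  assumes "(0, 0) \<in> R"
    and "\<And>f e g h. (f, e) \<in> R \<Longrightarrow> (g, h) \<in> R \<Longrightarrow> (f + g, e + h) \<in> R"
    and "\<And>c f e. (f, e) \<in> R \<Longrightarrow> (c *\<^sub>C f, c *\<^sub>C e) \<in> R"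
  shows "csubspace R"
  unfolding complex_vector.subspace_def
  using assms by (auto simp: zero_prod_def scaleC_prod_def)

lemma dissipative_relation_iff_inner:
  "dissipative_relation R \<longleftrightarrow> csubspace R \<and> (\<forall>(f, e)\<in>R. inner f e \<le> 0)"
  by (simp add: dissipative_relation_def inner_eq_Re_cinner)

text \<open>
  For \<open>w = cinner u y + cinner v x\<close> the member \<open>(u, v) + s w (x, y)\<close> of \<open>R\<close>, with \<open>s\<close> real, has the form
  \<open>Re (cinner u v) + s |w|\<^sup>2\<close>: there is no quadratic term, because \<open>(x, y)\<close> is neutral.  This is
  bounded above in \<open>s\<close> only if \<open>w = 0\<close>.
\<close>

lemma dissipative_relation_neutral_orthogonal:
  assumes R: "dissipative_relation R" and xy: "(x, y) \<in> R" "Re (cinner x y) = 0" and uv: "(u, v) \<in> R"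
  shows "cinner u y + cinner v x = 0"
proof (rule ccontr)
  define w where "w = cinner u y + cinner v x"
  assume "cinner u y + cinner v x \<noteq> 0"
  then have "w \<noteq> 0"
    by (simp add: w_def)
  \<comment> \<open>Chosen so that the form takes the value \<open>1\<close>.\<close>
  define s where "s = (1 - Re (cinner u v)) / (cmod w)\<^sup>2"
  define c where "c = complex_of_real s * w"
  have "(u + c *\<^sub>C x, v + c *\<^sub>C y) = (u, v) + c *\<^sub>C (x, y)"
    by (simp add: scaleC_prod_def)
  also have "\<dots> \<in> R"
    using R xy(1) uv unfolding dissipative_relation_def
    by (blast intro: complex_vector.subspace_add complex_vector.subspace_scale)
  finally have "Re (cinner (u + c *\<^sub>C x) (v + c *\<^sub>C y)) \<le> 0"
    using R unfolding dissipative_relation_def by blast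
  also have "cinner (u + c *\<^sub>C x) (v + c *\<^sub>C y)
      = cinner u v + (cnj c * cinner u y + c * cinner x v) + c * cnj c * cinner x y"
    by (simp add: cinner_add_left cinner_add_right cinner_scaleC_left cinner_scaleC_right algebra_simps)
  also have "Re \<dots> = Re (cinner u v) + Re (cnj c * w) + (cmod c)\<^sup>2 * Re (cinner x y)"
  proof -
    have "Re (c * cinner x v) = Re (cnj c * cinner v x)"
      by (subst cinner_commute) simp
    then show ?thesis
      unfolding w_def complex_norm_square[symmetric] by (simp add: algebra_simps)
  qed
  also have "Re (cnj c * w) = s * (cmod w)\<^sup>2"
    unfolding c_def cmod_power2 by (simp add: power2_eq_square algebra_simps)
  also have "\<dots> = 1 - Re (cinner u v)"
    using \<open>w \<noteq> 0\<close> by (simp add: s_def)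
  finally show False
    using xy(2) by simp
qed

text \<open>
  In the Cayley coordinates \<open>p = f - e\<close> and \<open>q = f + e\<close> a pair \<open>(f, e)\<close> is dissipative if and only if
  \<open>\<parallel>q\<parallel> \<le> \<parallel>p\<parallel>\<close>.  So a dissipative relation is the graph of a map \<open>p \<mapsto> q\<close> that does not increase
  norms.
\<close>

lemma norm_add_sq_eq_norm_diff_sq:
  "(norm (f + e))\<^sup>2 = (norm (f - e))\<^sup>2 + 4 * inner f e" for f e :: "'a::real_inner"
  unfolding power2_norm_eq_inner by (simp add: inner_commute algebra_simps)

lemma norm_add_le_norm_diff_iff:
  "norm (f + e) \<le> norm (f - e) \<longleftrightarrow> inner f e \<le> 0" for f e :: "'a::real_inner"
  using norm_add_sq_eq_norm_diff_sq[of f e] by (smt (verit) norm_ge_zero power2_le_imp_le power_mono)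

lemma pair_eq_0_if_diff_add_eq_0:
  fixes f e :: "'a::real_vector"
  assumes "f - e = 0" "f + e = 0"
  shows "f = 0 \<and> e = 0"
proof -
  have "f = e" using assms(1) by simp
  with assms(2) have "2 *\<^sub>R f = 0" by (simp add: scaleR_2)
  with \<open>f = e\<close> show ?thesis by simp
qed

lemma ex_pair_diff_add: "\<exists>f e. f - e = p \<and> f + e = q" for p q :: "'a::real_vector"
  by (intro exI[of _ "(1/2) *\<^sub>R (q + p)"] exI[of _ "(1/2) *\<^sub>R (q - p)"])
     (simp add: algebra_simps flip: scaleR_add_left)

lemma clinear_iff:
  "clinear V \<longleftrightarrow> (\<forall>x y. V (x + y) = V x + V y) \<and> (\<forall>c x. V (c *\<^sub>C x) = c *\<^sub>C V x)"
  by (auto simp: Vector_Spaces.linear_iff_module_hom complex_vector.module_axioms module_hom_def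
      module_hom_axioms_def)

lemma clinear_imp_linear: "clinear V \<Longrightarrow> linear V"
  by (rule linearI) (auto simp: clinear_iff scaleR_scaleC)

lemma contraction_iff: "contraction V \<longleftrightarrow> clinear V \<and> (\<forall>x. norm (V x) \<le> norm x)"
proof
  assume V: "contraction V"
  have "norm (V x) \<le> norm x" for x
  proof -
    have "norm (V x) \<le> onorm V * norm x"
      using V by (simp add: contraction_def onorm)
    also have "\<dots> \<le> norm x"
      using V by (simp add: contraction_def mult_left_le_one_le onorm_pos_le)
    finally show ?thesis .
  qed
  with V show "clinear V \<and> (\<forall>x. norm (V x) \<le> norm x)"
    by (simp add: contraction_def)
next
  assume V: "clinear V \<and> (\<forall>x. norm (V x) \<le> norm x)"
  then have "bounded_linear V"
    by (intro bounded_linear_intro[where K = 1]) (auto simp: clinear_iff scaleR_scaleC)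
  moreover have "onorm V \<le> 1"
    using V by (intro onorm_bound) auto
  ultimately show "contraction V"
    using V by (simp add: contraction_def)
qed

text \<open>
  In Cayley coordinates \<open>ker_row V\<close> is the graph of \<open>- V\<close>.
\<close>

lemma ker_row_iff:
  assumes "clinear V"
  shows "(f, e) \<in> ker_row V \<longleftrightarrow> f + e = - V (f - e)"
proof -
  have "V (f - e) = V f - V e"
    using assms by (intro linear_diff clinear_imp_linear)
  then have sum_eq: "(f + V f) + (e - V e) = (f + e) + V (f - e)"
    by simp
  show ?thesis
    unfolding ker_row_def eq_neg_iff_add_eq_0 mem_Collect_eq case_prod_conv sum_eq ..
qed

lemma ker_row_dissipative:
  assumes V: "contraction V"
  shows "dissipative_relation (ker_row V)"
proof -
  have lin: "clinear V" and le: "\<And>x. norm (V x) \<le> norm x"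
    using V by (auto simp: contraction_iff)
  have "csubspace (ker_row V)"
  proof (rule csubspace_pairI)
    have "V 0 = 0"
      using lin by (intro linear_0 clinear_imp_linear)
    then show "(0, 0) \<in> ker_row V"
      by (simp add: ker_row_iff[OF lin])
    show "(f + g, e + h) \<in> ker_row V" if "(f, e) \<in> ker_row V" "(g, h) \<in> ker_row V" for f e g h
    proof -
      have "V ((f + g) - (e + h)) = V (f - e) + V (g - h)"
        using lin by (simp add: add_diff_add clinear_iff)
      then show ?thesis
        using that unfolding ker_row_iff[OF lin] by (simp add: algebra_simps)
    qed
    show "(c *\<^sub>C f, c *\<^sub>C e) \<in> ker_row V" if "(f, e) \<in> ker_row V" for c f e
    proof -
      have "V (c *\<^sub>C f - c *\<^sub>C e) = c *\<^sub>C V (f - e)"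
        using lin by (simp add: clinear_iff flip: complex_vector.scale_right_diff_distrib)
      then show ?thesis
        using that unfolding ker_row_iff[OF lin]
        by (simp flip: scaleC_add_right complex_vector.scale_minus_right)
    qed
  qed
  moreover have "inner f e \<le> 0" if "(f, e) \<in> ker_row V" for f e
    using that le[of "f - e"] by (simp add: ker_row_iff[OF lin] norm_add_le_norm_diff_iff[symmetric])
  ultimately show ?thesis
    by (auto simp: dissipative_relation_iff_inner)
qed

text \<open>
  The graph of \<open>- V\<close> already contains a pair for each \<open>p\<close>.  A member of a dissipative extension differs
  from it by a pair with \<open>p = 0\<close>, and then \<open>q = 0\<close> too.
\<close>

lemma ker_row_maximal_dissipative:
  assumes V: "contraction V"
  shows "maximal_dissipative_relation (ker_row V)"
  unfolding maximal_dissipative_relation_def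
proof (intro conjI allI impI ker_row_dissipative[OF V] equalityI)
  fix S assume S: "dissipative_relation S \<and> ker_row V \<subseteq> S"
  then show "ker_row V \<subseteq> S" by blast
  have lin: "clinear V"
    using V by (simp add: contraction_iff)
  show "S \<subseteq> ker_row V"
  proof clarify
    fix f e assume fe: "(f, e) \<in> S"
    define p where "p = f - e"
    obtain f' e' where "f' - e' = p" "f' + e' = - V p"
      using ex_pair_diff_add by blast
    then have fe': "(f', e') \<in> ker_row V"
      by (simp add: ker_row_iff[OF lin])
    then have "(f, e) - (f', e') \<in> S"
      using S fe unfolding dissipative_relation_def by (blast intro: complex_vector.subspace_diff)
    then have "inner (f - f') (e - e') \<le> 0"
      using S by (auto simp: dissipative_relation_iff_inner)
    moreover have "e - e' = f - f'"
      using \<open>f' - e' = p\<close> by (simp add: p_def algebra_simps)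
    ultimately have "inner (f - f') (f - f') = 0"
      using inner_ge_zero[of "f - f'"] by simp
    then have "f = f'" "e = e'"
      using \<open>e - e' = f - f'\<close> by simp_all
    then show "(f, e) \<in> ker_row V"
      using fe' by simp
  qed
qed

lemma dissipative_relation_closure:
  fixes C :: "('b::chilbert_space \<times> 'b) set"
  assumes C: "dissipative_relation C"
  shows "dissipative_relation (closure C)"
proof -
  have sub: "csubspace C"
    using C by (simp add: dissipative_relation_def)
  have "closed {c::'b \<times> 'b. inner (fst c) (snd c) \<le> 0}"
    by (intro closed_Collect_le continuous_intros)
  moreover have "C \<subseteq> {c. inner (fst c) (snd c) \<le> 0}"
    using C by (auto simp: dissipative_relation_iff_inner)
  ultimately have "closure C \<subseteq> {c. inner (fst c) (snd c) \<le> 0}"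
    by (rule closure_minimal[rotated])
  moreover have "csubspace (closure C)"
    unfolding closure_eq_corthogonal_complement_twice[OF sub]
    by (rule csubspace_corthogonal_complement)
  ultimately show ?thesis
    by (auto simp: dissipative_relation_iff_inner)
qed

lemma maximal_dissipative_closed:
  fixes C :: "('b::chilbert_space \<times> 'b) set"
  assumes "maximal_dissipative_relation C"
  shows "closed C"
  using assms dissipative_relation_closure closure_subset closure_eq
  unfolding maximal_dissipative_relation_def by metis

text \<open>
  The values \<open>p = f - e\<close> form a closed subspace, since \<open>p\<close> controls the norm of \<open>(f, e)\<close> and \<open>C\<close> is
  closed.  If a nonzero \<open>p\<close> were orthogonal to it, then adding \<open>(p, - p)\<close>, whose Cayley coordinates are
  \<open>2 p\<close> and \<open>0\<close>, would give a proper dissipative extension: the norm of the first coordinate only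
  grows and the second does not change.
\<close>

lemma maximal_dissipative_diff_surj:
  fixes C :: "('b::chilbert_space \<times> 'b) set"
  assumes C: "maximal_dissipative_relation C"
  shows "(\<lambda>(f, e). f - e) ` C = UNIV"
proof -
  let ?d = "\<lambda>c::'b \<times> 'b. fst c - snd c"
  define P where "P = ?d ` C"
  have diss: "dissipative_relation C" and sub: "csubspace C"
    using C by (auto simp: maximal_dissipative_relation_def dissipative_relation_def)
  have subP: "csubspace P"
    unfolding P_def complex_vector.subspace_def
  proof (intro conjI ballI allI)
    show "0 \<in> ?d ` C"
      using complex_vector.subspace_0[OF sub] by force
    show "x + y \<in> ?d ` C" if "x \<in> ?d ` C" "y \<in> ?d ` C" for x y
    proof -
      from that obtain a b where "a \<in> C" "x = ?d a" "b \<in> C" "y = ?d b" by blast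
      then show ?thesis
        by (intro image_eqI[of _ _ "a + b"] complex_vector.subspace_add[OF sub]) simp_all
    qed
    show "c *\<^sub>C x \<in> ?d ` C" if "x \<in> ?d ` C" for c x
    proof -
      from that obtain a where "a \<in> C" "x = ?d a" by blast
      then show ?thesis
        by (intro image_eqI[of _ _ "c *\<^sub>C a"] complex_vector.subspace_scale[OF sub])
          (simp_all add: scaleC_prod_def complex_vector.scale_right_diff_distrib)
    qed
  qed
  have "closed P"
  proof -
    have "complete (?d ` C)"
    proof (rule complete_isometric_image[of 1])
      show "subspace C"
        using sub by (rule csubspace_imp_subspace)
      show "bounded_linear ?d"
        by (intro bounded_linear_intros)
      show "\<forall>x\<in>C. norm (?d x) \<ge> 1 * norm x"
      proof
        fix x assume "x \<in> C"
        then have "inner (fst x) (snd x) \<le> 0"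
          using diss by (auto simp: dissipative_relation_iff_inner)
        then have "(norm x)\<^sup>2 \<le> (norm (?d x))\<^sup>2"
          by (simp add: power2_norm_eq_inner inner_prod_def inner_commute algebra_simps)
        then show "norm (?d x) \<ge> 1 * norm x"
          using power2_le_imp_le by fastforce
      qed
      show "complete C"
        using maximal_dissipative_closed[OF C] by (simp add: complete_eq_closed)
    qed simp
    then show ?thesis
      by (simp add: P_def complete_eq_closed)
  qed
  have "corthogonal_complement P = {0}"
  proof
    show "corthogonal_complement P \<subseteq> {0}"
    proof
      fix p assume p: "p \<in> corthogonal_complement P"
      define S where "S = {(f + a *\<^sub>C p, e - a *\<^sub>C p) | f e a. (f, e) \<in> C}"
      have "csubspace S"
      proof (rule csubspace_pairI)
        show "(0, 0) \<in> S"
          unfolding S_def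
          by (intro CollectI exI[of _ 0])
            (use complex_vector.subspace_0[OF sub] in \<open>simp add: zero_prod_def\<close>)
        show "(f + g, e + h) \<in> S" if "(f, e) \<in> S" "(g, h) \<in> S" for f e g h
        proof -
          from that obtain f' e' a g' h' b where *:
            "f = f' + a *\<^sub>C p" "e = e' - a *\<^sub>C p" "(f', e') \<in> C"
            "g = g' + b *\<^sub>C p" "h = h' - b *\<^sub>C p" "(g', h') \<in> C"
            unfolding S_def by blast
          have "(f' + g', e' + h') \<in> C"
            using complex_vector.subspace_add[OF sub *(3,6)] by simp
          moreover have "f + g = (f' + g') + (a + b) *\<^sub>C p" "e + h = (e' + h') - (a + b) *\<^sub>C p"
            using * by (simp_all add: scaleC_add_left)
          ultimately show ?thesis
            unfolding S_def by blast
        qed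
        show "(c *\<^sub>C f, c *\<^sub>C e) \<in> S" if "(f, e) \<in> S" for c f e
        proof -
          from that obtain f' e' a where *: "f = f' + a *\<^sub>C p" "e = e' - a *\<^sub>C p" "(f', e') \<in> C"
            unfolding S_def by blast
          have "(c *\<^sub>C f', c *\<^sub>C e') \<in> C"
            using complex_vector.subspace_scale[OF sub *(3), of c] by (simp add: scaleC_prod_def)
          moreover have "c *\<^sub>C f = c *\<^sub>C f' + (c * a) *\<^sub>C p" "c *\<^sub>C e = c *\<^sub>C e' - (c * a) *\<^sub>C p"
            using * by (simp_all add: scaleC_add_right complex_vector.scale_right_diff_distrib)
          ultimately show ?thesis
            unfolding S_def by blast
        qed
      qed
      moreover have "inner f e \<le> 0" if "(f, e) \<in> S" for f e
      proof -
        from that obtain f' e' a where *: "f = f' + a *\<^sub>C p" "e = e' - a *\<^sub>C p" "(f', e') \<in> C"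
          unfolding S_def by blast
        have "f' - e' \<in> P"
          unfolding P_def using *(3) by force
        then have "cinner (f' - e') p = 0"
          using p unfolding corthogonal_complement_def by blast
        then have "inner (f' - e') (a *\<^sub>C p) = 0"
          by (simp add: inner_eq_Re_cinner cinner_scaleC_right)
        then have "inner f e = inner f' e' - inner (a *\<^sub>C p) (a *\<^sub>C p)"
          unfolding * by (simp add: inner_commute algebra_simps)
        moreover have "inner f' e' \<le> 0"
          using diss *(3) by (auto simp: dissipative_relation_iff_inner)
        ultimately show ?thesis
          using inner_ge_zero[of "a *\<^sub>C p"] by linarith
      qed
      ultimately have "dissipative_relation S"
        by (auto simp: dissipative_relation_iff_inner)
      moreover have "C \<subseteq> S"
      proof clarify
        fix f e assume "(f, e) \<in> C"
        then show "(f, e) \<in> S"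
          unfolding S_def by (intro CollectI exI[of _ f] exI[of _ e] exI[of _ 0]) simp
      qed
      ultimately have "S = C"
        using C unfolding maximal_dissipative_relation_def by blast
      moreover have "(p, - p) \<in> S"
        unfolding S_def
        by (intro CollectI exI[of _ 0] exI[of _ 0] exI[of _ 1])
          (use complex_vector.subspace_0[OF sub] in \<open>simp add: scaleC_one zero_prod_def\<close>)
      ultimately have "p + p \<in> P"
        unfolding P_def by force
      then have "cinner (p + p) p = 0"
        using p unfolding corthogonal_complement_def by blast
      then have "cinner p p = 0"
        by (simp add: cinner_add_left)
      then show "p \<in> {0}"
        by (simp add: cinner_self_eq_0)
    qed
  qed (simp add: corthogonal_complement_def)
  then have "closure P = UNIV"
    unfolding closure_eq_corthogonal_complement_twice[OF subP] by (simp add: corthogonal_complement_def)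
  with \<open>closed P\<close> have "P = UNIV"
    by simp
  then show ?thesis
    unfolding P_def by (simp add: case_prod_unfold)
qed

lemma maximal_dissipative_imp_ker_row:
  fixes C :: "('b::chilbert_space \<times> 'b) set"
  assumes C: "maximal_dissipative_relation C"
  shows "\<exists>V. contraction V \<and> C = ker_row V"
proof -
  have diss: "dissipative_relation C" and sub: "csubspace C"
    using C by (auto simp: maximal_dissipative_relation_def dissipative_relation_def)
  have le: "norm (f + e) \<le> norm (f - e)" if "(f, e) \<in> C" for f e
    using diss that by (auto simp: dissipative_relation_iff_inner norm_add_le_norm_diff_iff)
  have unique: "f = f' \<and> e = e'" if "(f, e) \<in> C" "(f', e') \<in> C" "f - e = f' - e'" for f e f' e'
  proof -
    have "(f - f', e - e') \<in> C"
      using complex_vector.subspace_diff[OF sub that(1,2)] by simp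
    from le[OF this] have "(f - f') + (e - e') = 0" "(f - f') - (e - e') = 0"
      using that(3) by (simp_all add: algebra_simps)
    then show ?thesis
      using pair_eq_0_if_diff_add_eq_0[of "f - f'" "e - e'"] by simp
  qed
  have "\<exists>f e. (f, e) \<in> C \<and> f - e = p" for p
  proof -
    have "p \<in> (\<lambda>(f, e). f - e) ` C"
      unfolding maximal_dissipative_diff_surj[OF C] by (rule UNIV_I)
    then show ?thesis
      by force
  qed
  then obtain F E where FE: "\<And>p. (F p, E p) \<in> C" "\<And>p. F p - E p = p"
    by metis
  define V where "V p = - (F p + E p)" for p
  have V: "V (f - e) = - (f + e)" if "(f, e) \<in> C" for f e
    using unique[OF FE(1) that FE(2)] by (simp add: V_def)
  have "clinear V"
    unfolding clinear_iff
  proof (intro conjI allI)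
    fix p q
    have "(F p + F q, E p + E q) \<in> C"
      using complex_vector.subspace_add[OF sub FE(1)[of p] FE(1)[of q]] by simp
    from V[OF this] show "V (p + q) = V p + V q"
      using FE(2)[of p] FE(2)[of q] by (simp add: V_def[of p] V_def[of q] add_diff_add)
  next
    fix c p
    have "(c *\<^sub>C F p, c *\<^sub>C E p) \<in> C"
      using complex_vector.subspace_scale[OF sub FE(1)[of p], of c] by (simp add: scaleC_prod_def)
    moreover have "c *\<^sub>C F p - c *\<^sub>C E p = c *\<^sub>C p"
      using FE(2)[of p] by (simp flip: complex_vector.scale_right_diff_distrib)
    ultimately have "V (c *\<^sub>C p) = - (c *\<^sub>C F p + c *\<^sub>C E p)"
      using V by metis
    then show "V (c *\<^sub>C p) = c *\<^sub>C V p"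
      by (simp only: V_def[of p] scaleC_add_right complex_vector.scale_minus_right)
  qed
  moreover have "norm (V p) \<le> norm p" for p
    using le[OF FE(1)[of p]] FE(2)[of p] unfolding V_def norm_minus_cancel by simp
  ultimately have "contraction V"
    by (simp add: contraction_iff)
  moreover have "C = ker_row V"
  proof -
    have "(f, e) \<in> C" if "f + e = - V (f - e)" for f e
    proof -
      define p where "p = f - e"
      have "(f - F p) + (e - E p) = 0" "(f - F p) - (e - E p) = 0"
        using that FE(2)[of p] by (simp_all add: V_def p_def algebra_simps)
      then have "f = F p" "e = E p"
        using pair_eq_0_if_diff_add_eq_0 by fastforce+
      then show ?thesis
        using FE(1) by simp
    qed
    moreover have "f + e = - V (f - e)" if "(f, e) \<in> C" for f e
      using V[OF that] by simp
    ultimately have "(f, e) \<in> C \<longleftrightarrow> (f, e) \<in> ker_row V" for f e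
      unfolding ker_row_iff[OF \<open>clinear V\<close>] by blast
    then show ?thesis
      by (simp add: set_eq_iff)
  qed
  ultimately show ?thesis
    by blast
qed

section \<open>Relations equal to their swapped orthogonal complement\<close>

lemma mem_swap_corthogonal_complement_iff:
  "(u, v) \<in> prod.swap ` corthogonal_complement C \<longleftrightarrow> (\<forall>(f, e)\<in>C. cinner f v + cinner e u = 0)"
proof -
  have "(u, v) \<in> prod.swap ` corthogonal_complement C \<longleftrightarrow> (v, u) \<in> corthogonal_complement C"
    by force
  then show ?thesis
    by (auto simp: corthogonal_complement_def cinner_prod_def)
qed

lemma csubspace_swap_corthogonal_complement:
  "csubspace (prod.swap ` corthogonal_complement C)"
proof (rule csubspace_pairI)
  let ?K = "corthogonal_complement C"
  have mem: "(f, e) \<in> prod.swap ` ?K \<longleftrightarrow> (e, f) \<in> ?K" for f e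
    by force
  note K = csubspace_corthogonal_complement[of C]
  show "(0, 0) \<in> prod.swap ` ?K"
    using complex_vector.subspace_0[OF K] by (simp add: mem zero_prod_def)
  show "(f + g, e + h) \<in> prod.swap ` ?K"
    if "(f, e) \<in> prod.swap ` ?K" "(g, h) \<in> prod.swap ` ?K" for f e g h
    using complex_vector.subspace_add[OF K that[unfolded mem]] by (simp add: mem)
  show "(c *\<^sub>C f, c *\<^sub>C e) \<in> prod.swap ` ?K" if "(f, e) \<in> prod.swap ` ?K" for c f e
    using complex_vector.subspace_scale[OF K that[unfolded mem]] by (simp add: mem scaleC_prod_def)
qed

text \<open>
  The form that defines the swapped complement is half the difference of the inner products of the two
  Cayley coordinates.  Hence the graph \<open>q = - V p\<close> lies in its swapped complement exactly when \<open>V\<close>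
  preserves inner products.
\<close>

lemma mem_swap_corthogonal_complement_iff_cayley:
  "(u, v) \<in> prod.swap ` corthogonal_complement C \<longleftrightarrow>
    (\<forall>(f, e)\<in>C. cinner (f + e) (u + v) = cinner (f - e) (u - v))"
proof -
  have "cinner (f + e) (u + v) - cinner (f - e) (u - v) = 2 * (cinner f v + cinner e u)" for f e
    by (simp add: cinner_add_left cinner_add_right cinner_diff_left cinner_diff_right algebra_simps)
  then have "cinner f v + cinner e u = 0 \<longleftrightarrow> cinner (f + e) (u + v) = cinner (f - e) (u - v)" for f e
    by (metis eq_iff_diff_eq_0 mult_eq_0_iff zero_neq_numeral)
  then show ?thesis
    unfolding mem_swap_corthogonal_complement_iff by simp
qed

definition relation_neg :: "('h::complex_vector \<times> 'h) set \<Rightarrow> ('h \<times> 'h) set" where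
  "relation_neg R = (\<lambda>(r1, r2). (r1, - r2)) ` R"

lemma mem_relation_neg_iff: "(f, e) \<in> relation_neg R \<longleftrightarrow> (f, - e) \<in> R"
  unfolding relation_neg_def by force

lemma swap_complement_relation_neg:
  "prod.swap ` corthogonal_complement (relation_neg C)
    = relation_neg (prod.swap ` corthogonal_complement C)"
proof (rule set_eqI, clarify)
  fix u v
  show "(u, v) \<in> prod.swap ` corthogonal_complement (relation_neg C) \<longleftrightarrow>
      (u, v) \<in> relation_neg (prod.swap ` corthogonal_complement C)"
    unfolding mem_relation_neg_iff mem_swap_corthogonal_complement_iff
    by (auto simp: relation_neg_def)
qed

text \<open>
  All members of \<open>C\<close> are neutral.  So every member of a dissipative extension satisfies the equations
  that define the swapped complement, which is \<open>C\<close>.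
\<close>

lemma self_swap_complement_maximal_dissipative:
  assumes C: "C = prod.swap ` corthogonal_complement C"
  shows "maximal_dissipative_relation C"
proof -
  have mem: "(u, v) \<in> C \<longleftrightarrow> (\<forall>(f, e)\<in>C. cinner f v + cinner e u = 0)" for u v
    using mem_swap_corthogonal_complement_iff[of u v C] C by simp
  have neutral: "Re (cinner f e) = 0" if "(f, e) \<in> C" for f e
  proof -
    have "cinner f e + cinner e f = 0"
      using mem[of f e] that by blast
    then have "Re (cinner f e) + Re (cinner e f) = 0"
      by (metis plus_complex.sel(1) zero_complex.sel(1))
    moreover have "Re (cinner e f) = Re (cinner f e)"
      by (subst cinner_commute) simp
    ultimately show ?thesis
      by simp
  qed
  have "csubspace C"
    by (subst C) (rule csubspace_swap_corthogonal_complement)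
  show ?thesis
    unfolding maximal_dissipative_relation_def
  proof (intro conjI allI impI equalityI)
    show "dissipative_relation C"
      using neutral \<open>csubspace C\<close> by (auto simp: dissipative_relation_def)
    fix S assume S: "dissipative_relation S \<and> C \<subseteq> S"
    then show "C \<subseteq> S"
      by blast
    show "S \<subseteq> C"
    proof clarify
      fix u v assume uv: "(u, v) \<in> S"
      have "cinner f v + cinner e u = 0" if "(f, e) \<in> C" for f e
      proof -
        have "cinner u e + cinner v f = 0"
          using dissipative_relation_neutral_orthogonal[of S f e u v] S that neutral uv by blast
        then have "cnj (cinner u e + cinner v f) = 0"
          by simp
        then show ?thesis
          by (simp add: cinner_commute[symmetric] add.commute)
      qed
      then show "(u, v) \<in> C"
        using mem by blast
    qed
  qed
qed

text \<open>
  Negating second components exchanges the two Cayley coordinates and preserves the equation for \<open>C\<close>.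
  So \<open>C\<close> is the graph of a map \<open>p \<mapsto> q\<close> and also of a map \<open>q \<mapsto> p\<close>, both everywhere defined; the second one makes \<open>V\<close> surjective.  Conversely, for a unitary \<open>V\<close> the equations of the
  swapped complement say that \<open>q + V p\<close> is orthogonal to the range of \<open>V\<close>, hence zero.
\<close>

lemma self_swap_complement_iff_unitary:
  fixes C :: "('b::chilbert_space \<times> 'b) set"
  shows "C = prod.swap ` corthogonal_complement C \<longleftrightarrow> (\<exists>V. unitary V \<and> C = ker_row V)"
proof
  assume C: "C = prod.swap ` corthogonal_complement C"
  obtain V where V: "contraction V" "C = ker_row V"
    using self_swap_complement_maximal_dissipative[OF C] maximal_dissipative_imp_ker_row by blast
  have "relation_neg C = prod.swap ` corthogonal_complement (relation_neg C)"
    unfolding swap_complement_relation_neg using C by simp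
  then obtain W where W: "contraction W" "relation_neg C = ker_row W"
    using self_swap_complement_maximal_dissipative maximal_dissipative_imp_ker_row by blast
  have linV: "clinear V" and linW: "clinear W"
    using V W by (auto simp: contraction_iff)
  have memV: "(f, e) \<in> C \<longleftrightarrow> f + e = - V (f - e)" for f e
    by (simp add: V ker_row_iff linV)
  have memW: "(f, e) \<in> C \<longleftrightarrow> f - e = - W (f + e)" for f e
    using mem_relation_neg_iff[of f "- e" C] by (simp add: W ker_row_iff linW)
  have "surj V"
  proof (rule surjI)
    fix y
    obtain f e where fe: "f - e = - W (- y)" "f + e = - y"
      using ex_pair_diff_add by blast
    then have "(f, e) \<in> C"
      by (simp add: memW)
    then show "V (- W (- y)) = y"
      using fe by (simp add: memV)
  qed
  moreover have "cinner (V x) (V y) = cinner x y" for x y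
  proof -
    obtain f e where fe: "f - e = x" "f + e = - V x"
      using ex_pair_diff_add by blast
    obtain u v where uv: "u - v = y" "u + v = - V y"
      using ex_pair_diff_add by blast
    have "(f, e) \<in> C"
      using fe by (simp add: memV)
    moreover have "(u, v) \<in> prod.swap ` corthogonal_complement C"
      using uv memV[of u v] C by simp
    ultimately have "cinner (f + e) (u + v) = cinner (f - e) (u - v)"
      unfolding mem_swap_corthogonal_complement_iff_cayley by blast
    then show ?thesis
      by (simp add: fe uv)
  qed
  ultimately show "\<exists>V. unitary V \<and> C = ker_row V"
    using linV V(2) by (auto simp: unitary_def)
next
  assume "\<exists>V. unitary V \<and> C = ker_row V"
  then obtain V where V: "clinear V" "surj V" "\<And>x y. cinner (V x) (V y) = cinner x y"
    and C: "C = ker_row V"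
    by (auto simp: unitary_def)
  show "C = prod.swap ` corthogonal_complement C"
  proof (rule set_eqI, clarify)
    fix u v
    have "(u, v) \<in> prod.swap ` corthogonal_complement C \<longleftrightarrow>
        (\<forall>p. cinner (- V p) (u + v) = cinner p (u - v))"
      unfolding mem_swap_corthogonal_complement_iff_cayley C
    proof (intro iffI allI ballI)
      fix p assume *: "\<forall>(f, e)\<in>ker_row V. cinner (f + e) (u + v) = cinner (f - e) (u - v)"
      obtain f e where fe: "f - e = p" "f + e = - V p"
        using ex_pair_diff_add by blast
      then have "(f, e) \<in> ker_row V"
        by (simp add: ker_row_iff[OF V(1)])
      then show "cinner (- V p) (u + v) = cinner p (u - v)"
        using * fe by fastforce
    next
      fix c assume *: "\<forall>p. cinner (- V p) (u + v) = cinner p (u - v)" and c: "c \<in> ker_row V"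
      obtain f e where "c = (f, e)" "f + e = - V (f - e)"
        using c by (metis surj_pair ker_row_iff[OF V(1)])
      then show "case c of (f, e) \<Rightarrow> cinner (f + e) (u + v) = cinner (f - e) (u - v)"
        using *[rule_format, of "f - e"] by simp
    qed
    also have "\<dots> \<longleftrightarrow> (\<forall>p. cinner (V p) (u + v + V (u - v)) = 0)"
    proof -
      have "cinner (- V p) (u + v) = cinner p (u - v) \<longleftrightarrow> cinner (V p) (u + v + V (u - v)) = 0" for p
        using V(3)[of p "u - v"] by (simp only: cinner_add_right[of "V p" "u + v"] cinner_minus_left
            neg_eq_iff_add_eq_0)
      then show ?thesis
        by simp
    qed
    also have "\<dots> \<longleftrightarrow> u + v + V (u - v) = 0"
    proof
      assume *: "\<forall>p. cinner (V p) (u + v + V (u - v)) = 0"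
      obtain p where "V p = u + v + V (u - v)"
        using V(2) by (metis surjD)
      then show "u + v + V (u - v) = 0"
        using *[rule_format, of p] by (simp add: cinner_self_eq_0)
    qed simp
    also have "\<dots> \<longleftrightarrow> (u, v) \<in> C"
      by (simp add: C ker_row_iff[OF V(1)] eq_neg_iff_add_eq_0)
    finally show "(u, v) \<in> C \<longleftrightarrow> (u, v) \<in> prod.swap ` corthogonal_complement C"
      by simp
  qed
qed

section \<open>Operators with boundary maps\<close>

text \<open>
  The set \<open>E\<close> and the map \<open>t\<close> stand for the domain and the values of \<open>A\<^sub>0\<^sup>*\<close>.  The last assumption is
  what remains of \<open>t\<close> being an adjoint: an element of the adjoint of \<open>- t\<close> restricted to the joint kernel
  of the boundary maps is an element of the graph of \<open>t\<close>.  In this form the setting is invariant under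
  \<open>(t, B1, B2) \<mapsto> (- t, B1, - B2)\<close>, which turns dissipative into accretive.
\<close>

locale green_triple =
  fixes E :: "'x::chilbert_space set" and t :: "'x \<Rightarrow> 'x" and B1 B2 :: "'x \<Rightarrow> 'b::chilbert_space"
  assumes t: "clinear_on E t" and B1: "clinear_on E B1" and B2: "clinear_on E B2"
    and surj: "(\<lambda>x. (B1 x, B2 x)) ` E = UNIV"
    and green: "\<lbrakk>x \<in> E; y \<in> E\<rbrakk> \<Longrightarrow>
      cinner (t x) y + cinner x (t y) = cinner (B1 x) (B2 y) + cinner (B2 x) (B1 y)"
    and adjoint_on_kernel:
      "(\<And>x. \<lbrakk>x \<in> E; B1 x = 0; B2 x = 0\<rbrakk> \<Longrightarrow> cinner (t x) u + cinner x v = 0) \<Longrightarrow> u \<in> E \<and> t u = v"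
begin

definition bmap :: "'x \<Rightarrow> 'b \<times> 'b" where
  "bmap x = (B1 x, B2 x)"

definition graph_on :: "'x set \<Rightarrow> ('x \<times> 'x) set" where
  "graph_on D = (\<lambda>x. (x, t x)) ` D"

definition kernel :: "'x set" where
  "kernel = {x \<in> E. bmap x = 0}"

lemma csubspace_E: "csubspace E"
  using t by (simp add: clinear_on_def)

lemma mem_kernel_iff: "x \<in> kernel \<longleftrightarrow> x \<in> E \<and> B1 x = 0 \<and> B2 x = 0"
  by (simp add: kernel_def bmap_def zero_prod_def)

lemma mem_graph_on_iff: "(u, v) \<in> graph_on D \<longleftrightarrow> u \<in> D \<and> v = t u"
  by (auto simp: graph_on_def)

lemma t_add: "\<lbrakk>x \<in> E; y \<in> E\<rbrakk> \<Longrightarrow> t (x + y) = t x + t y"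
  and t_scale: "x \<in> E \<Longrightarrow> t (c *\<^sub>C x) = c *\<^sub>C t x"
  using t by (auto simp: clinear_on_def)

lemma bmap_add: "\<lbrakk>x \<in> E; y \<in> E\<rbrakk> \<Longrightarrow> bmap (x + y) = bmap x + bmap y"
  and bmap_scale: "x \<in> E \<Longrightarrow> bmap (c *\<^sub>C x) = c *\<^sub>C bmap x"
  using B1 B2 by (auto simp: clinear_on_def bmap_def scaleC_prod_def)

lemma t_0: "t 0 = 0"
  using t_scale[of 0 0] complex_vector.subspace_0[OF csubspace_E] by simp

lemma bmap_0: "bmap 0 = 0"
  using bmap_scale[of 0 0] complex_vector.subspace_0[OF csubspace_E] by simp

lemma bmap_diff: "\<lbrakk>x \<in> E; y \<in> E\<rbrakk> \<Longrightarrow> bmap (x - y) = bmap x - bmap y"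
  using bmap_add[of "x - y" y] complex_vector.subspace_diff[OF csubspace_E] by fastforce

lemma bmap_onto: obtains x where "x \<in> E" "bmap x = b"
proof -
  have "b \<in> (\<lambda>x. (B1 x, B2 x)) ` E"
    unfolding surj by (rule UNIV_I)
  then show thesis
    using that by (auto simp: bmap_def)
qed

lemma inner_t: "x \<in> E \<Longrightarrow> inner x (t x) = inner (B1 x) (B2 x)"
proof -
  assume "x \<in> E"
  then have "Re (cinner (t x) x + cinner x (t x)) = Re (cinner (B1 x) (B2 x) + cinner (B2 x) (B1 x))"
    by (simp only: green)
  then show ?thesis
    by (simp add: inner_eq_Re_cinner[symmetric] inner_commute)
qed

text \<open>
  Two elements with the same boundary values differ by an element of the joint kernel.
\<close>

lemma domain_eq_vimage:
  assumes D: "csubspace D" "D \<subseteq> E" "kernel \<subseteq> D"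
  shows "{d \<in> E. bmap d \<in> bmap ` D} = D"
proof
  show "{d \<in> E. bmap d \<in> bmap ` D} \<subseteq> D"
  proof clarify
    fix d d' assume d: "d \<in> E" "d' \<in> D" "bmap d = bmap d'"
    then have "d - d' \<in> kernel"
      using D(2) by (auto simp: kernel_def bmap_diff complex_vector.subspace_diff[OF csubspace_E])
    then have "(d - d') + d' \<in> D"
      using D d(2) complex_vector.subspace_add by blast
    then show "d \<in> D" by simp
  qed
qed (use D in auto)

lemma bmap_vimage: "bmap ` {d \<in> E. bmap d \<in> C} = C"
proof -
  have "c \<in> bmap ` {d \<in> E. bmap d \<in> C}" if "c \<in> C" for c
  proof -
    obtain x where "x \<in> E" "bmap x = c"
      by (rule bmap_onto)
    with that show ?thesis
      by auto
  qed
  then show ?thesis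
    by auto
qed

lemma csubspace_vimage:
  assumes "csubspace C"
  shows "csubspace {d \<in> E. bmap d \<in> C}"
  using assms csubspace_E unfolding complex_vector.subspace_def
  by (simp add: bmap_0 bmap_add bmap_scale)

lemma csubspace_bmap:
  assumes D: "csubspace D" "D \<subseteq> E"
  shows "csubspace (bmap ` D)"
  unfolding complex_vector.subspace_def
proof (intro conjI ballI allI)
  show "0 \<in> bmap ` D"
    using bmap_0 complex_vector.subspace_0[OF D(1)] by (metis imageI)
  show "x + y \<in> bmap ` D" if "x \<in> bmap ` D" "y \<in> bmap ` D" for x y
    using that D complex_vector.subspace_add[OF D(1)] by (auto simp: bmap_add[symmetric] subset_iff)
  show "c *\<^sub>C x \<in> bmap ` D" if "x \<in> bmap ` D" for c x
    using that D complex_vector.subspace_scale[OF D(1)] by (auto simp: bmap_scale[symmetric] subset_iff)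
qed

lemma csubspace_graph_on:
  assumes D: "csubspace D" "D \<subseteq> E"
  shows "csubspace (graph_on D)"
proof (rule csubspace_pairI)
  note sub = complex_vector.subspace_0[OF D(1)] complex_vector.subspace_add[OF D(1)]
    complex_vector.subspace_scale[OF D(1)]
  show "(0, 0) \<in> graph_on D"
    using sub by (simp add: mem_graph_on_iff t_0)
  show "(f + g, e + h) \<in> graph_on D" if "(f, e) \<in> graph_on D" "(g, h) \<in> graph_on D" for f e g h
    using that sub D(2) by (auto simp: mem_graph_on_iff t_add subset_iff)
  show "(c *\<^sub>C f, c *\<^sub>C e) \<in> graph_on D" if "(f, e) \<in> graph_on D" for c f e
    using that sub D(2) by (auto simp: mem_graph_on_iff t_scale subset_iff)
qed

text \<open>
  A domain \<open>D\<close> that contains the joint kernel is large enough to force \<open>v \<in> E\<close> and \<open>t v = u\<close>.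
  Green's identity then turns orthogonality to the graph into orthogonality of boundary values.
\<close>

lemma mem_orthogonal_graph_iff:
  assumes D: "D \<subseteq> E" "kernel \<subseteq> D"
  shows "(u, v) \<in> corthogonal_complement (graph_on D) \<longleftrightarrow>
    v \<in> E \<and> t v = u \<and> prod.swap (bmap v) \<in> corthogonal_complement (bmap ` D)"
proof -
  have mem: "(u, v) \<in> corthogonal_complement (graph_on D) \<longleftrightarrow> (\<forall>x\<in>D. cinner (t x) v + cinner x u = 0)"
    by (simp add: corthogonal_complement_def graph_on_def cinner_prod_def add.commute)
  have swap: "prod.swap (bmap v) \<in> corthogonal_complement (bmap ` D) \<longleftrightarrow>
      (\<forall>x\<in>D. cinner (t x) v + cinner x (t v) = 0)" if "v \<in> E" for v
    using green[OF _ that] D(1) by (auto simp: corthogonal_complement_def bmap_def cinner_prod_def subset_iff)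
  show ?thesis
  proof
    assume orth: "(u, v) \<in> corthogonal_complement (graph_on D)"
    then have "v \<in> E \<and> t v = u"
      using D(2) by (intro adjoint_on_kernel) (auto simp: mem mem_kernel_iff subset_iff)
    with orth show "v \<in> E \<and> t v = u \<and> prod.swap (bmap v) \<in> corthogonal_complement (bmap ` D)"
      using swap by (auto simp: mem)
  next
    assume "v \<in> E \<and> t v = u \<and> prod.swap (bmap v) \<in> corthogonal_complement (bmap ` D)"
    then show "(u, v) \<in> corthogonal_complement (graph_on D)"
      using swap by (auto simp: mem)
  qed
qed

text \<open>
  If \<open>v\<close> is orthogonal to the joint kernel, then \<open>(0, v)\<close> belongs to the graph of \<open>t\<close>, so
  \<open>v = t 0 = 0\<close>.
\<close>

lemma orthogonal_complement_domain:
  assumes D: "D \<subseteq> E" "kernel \<subseteq> D"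
  shows "corthogonal_complement D = {0}"
proof -
  have "v = 0" if "v \<in> corthogonal_complement D" for v
  proof -
    have "cinner (t x) 0 + cinner x v = 0" if "x \<in> E" "B1 x = 0" "B2 x = 0" for x
      using that D(2) \<open>v \<in> corthogonal_complement D\<close>
      by (auto simp: corthogonal_complement_def mem_kernel_iff subset_iff)
    then show ?thesis
      using adjoint_on_kernel[of 0 v] t_0 by simp
  qed
  then show ?thesis
    by (auto simp: corthogonal_complement_def)
qed

text \<open>
  The closure is the double orthogonal complement.  The first complement is again a graph, with the two
  coordinates exchanged, over a domain that contains the joint kernel; so the description of orthogonal
  complements of graphs applies twice and produces the double complement of the boundary values.
\<close>

lemma closure_graph_on:
  assumes D: "csubspace D" "D \<subseteq> E" "kernel \<subseteq> D"
  shows "closure (graph_on D) = graph_on {d \<in> E. bmap d \<in> closure (bmap ` D)}"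
proof -
  let ?K = "corthogonal_complement (bmap ` D)"
  define D' where "D' = {v \<in> E. prod.swap (bmap v) \<in> ?K}"
  have "kernel \<subseteq> D'"
    using complex_vector.subspace_0[OF csubspace_corthogonal_complement[of "bmap ` D"]]
    by (auto simp: D'_def kernel_def zero_prod_def)
  have bmap_D': "bmap ` D' = prod.swap ` ?K"
  proof -
    have "prod.swap c \<in> ?K \<longleftrightarrow> c \<in> prod.swap ` ?K" for c
      by force
    then have "D' = {v \<in> E. bmap v \<in> prod.swap ` ?K}"
      unfolding D'_def by blast
    then show ?thesis
      using bmap_vimage by simp
  qed
  have "(u, v) \<in> closure (graph_on D) \<longleftrightarrow> u \<in> E \<and> v = t u \<and> bmap u \<in> closure (bmap ` D)" for u v
  proof -
    have "(u, v) \<in> closure (graph_on D) \<longleftrightarrow>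
        (\<forall>w\<in>corthogonal_complement (graph_on D). cinner w (u, v) = 0)"
      using closure_eq_corthogonal_complement_twice[OF csubspace_graph_on[OF D(1,2)]]
      by (simp add: corthogonal_complement_def[of "corthogonal_complement (graph_on D)"])
    also have "\<dots> \<longleftrightarrow> (\<forall>y\<in>D'. cinner (t y, y) (u, v) = 0)"
      unfolding split_paired_Ball_Sigma Ball_def split_paired_All mem_orthogonal_graph_iff[OF D(2,3)]
      by (auto simp: D'_def)
    also have "\<dots> \<longleftrightarrow> (v, u) \<in> corthogonal_complement (graph_on D')"
      by (auto simp: corthogonal_complement_def graph_on_def cinner_prod_def add.commute)
    also have "\<dots> \<longleftrightarrow> u \<in> E \<and> t u = v \<and> prod.swap (bmap u) \<in> corthogonal_complement (bmap ` D')"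
      using \<open>kernel \<subseteq> D'\<close> by (intro mem_orthogonal_graph_iff) (auto simp: D'_def)
    also have "prod.swap (bmap u) \<in> corthogonal_complement (bmap ` D') \<longleftrightarrow>
        bmap u \<in> corthogonal_complement ?K"
      unfolding bmap_D' by (simp add: corthogonal_complement_def cinner_prod_def add.commute)
    also have "corthogonal_complement ?K = closure (bmap ` D)"
      using closure_eq_corthogonal_complement_twice[OF csubspace_bmap[OF D(1,2)]] by simp
    finally show ?thesis
      by auto
  qed
  then show ?thesis
    by (auto simp: mem_graph_on_iff set_eq_iff)
qed

lemma closed_graph_on_iff:
  assumes D: "csubspace D" "D \<subseteq> E" "kernel \<subseteq> D"
  shows "closed (graph_on D) \<longleftrightarrow> closed (bmap ` D)"
proof
  assume "closed (bmap ` D)"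
  then have "closure (graph_on D) = graph_on D"
    using closure_graph_on[OF D] domain_eq_vimage[OF D] by simp
  then show "closed (graph_on D)"
    by (simp add: closure_eq)
next
  assume "closed (graph_on D)"
  then have "graph_on D = graph_on {d \<in> E. bmap d \<in> closure (bmap ` D)}"
    using closure_graph_on[OF D] by simp
  then have "D = {d \<in> E. bmap d \<in> closure (bmap ` D)}"
    unfolding set_eq_iff split_paired_All mem_graph_on_iff by blast
  then have "bmap ` D = closure (bmap ` D)"
    using bmap_vimage by metis
  then show "closed (bmap ` D)"
    by (metis closed_closure)
qed

lemma dissipative_graph_on_iff:
  assumes D: "csubspace D" "D \<subseteq> E"
  shows "dissipative_relation (graph_on D) \<longleftrightarrow> dissipative_relation (bmap ` D)"
  using csubspace_graph_on[OF D] csubspace_bmap[OF D] inner_t D(2)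
  by (auto simp: dissipative_relation_iff_inner graph_on_def bmap_def subset_iff)

text \<open>
  The graph over the joint kernel consists of neutral pairs, so each member of \<open>R\<close> is orthogonal to them
  in the sense of the adjoint.  Therefore the extensions that are to be compared with a graph are graphs
  of restrictions of \<open>t\<close>, although maximality refers to arbitrary relations.
\<close>

lemma dissipative_extension_is_graph:
  assumes R: "dissipative_relation R" and ext: "graph_on kernel \<subseteq> R"
  shows "R = graph_on {x \<in> E. (x, t x) \<in> R}"
proof -
  have "u \<in> E \<and> t u = v" if uv: "(u, v) \<in> R" for u v
  proof (rule adjoint_on_kernel)
    fix x assume x: "x \<in> E" "B1 x = 0" "B2 x = 0"
    then have "(x, t x) \<in> R" "Re (cinner x (t x)) = 0"
      using ext inner_t[of x] by (auto simp: mem_graph_on_iff mem_kernel_iff inner_eq_Re_cinner[symmetric])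
    then have "cinner u (t x) + cinner v x = 0"
      using R uv by (intro dissipative_relation_neutral_orthogonal)
    then have "cnj (cinner u (t x) + cinner v x) = 0"
      by simp
    then show "cinner (t x) u + cinner x v = 0"
      by (simp add: cinner_commute[symmetric])
  qed
  then show ?thesis
    by (auto simp: set_eq_iff mem_graph_on_iff)
qed

text \<open>
  Restrictions of \<open>t\<close> to domains that contain the joint kernel correspond, in an order preserving way, to
  subspaces of the boundary space; dissipative extensions on one side give dissipative extensions on the
  other.
\<close>

lemma maximal_dissipative_graph_on_iff:
  assumes D: "csubspace D" "D \<subseteq> E" "kernel \<subseteq> D"
  shows "maximal_dissipative_relation (graph_on D) \<longleftrightarrow> maximal_dissipative_relation (bmap ` D)"
proof
  assume max: "maximal_dissipative_relation (graph_on D)"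
  show "maximal_dissipative_relation (bmap ` D)"
    unfolding maximal_dissipative_relation_def
  proof (intro conjI allI impI)
    show "dissipative_relation (bmap ` D)"
      using max dissipative_graph_on_iff[OF D(1,2)] by (simp add: maximal_dissipative_relation_def)
    fix S assume S: "dissipative_relation S \<and> bmap ` D \<subseteq> S"
    define DS where "DS = {d \<in> E. bmap d \<in> S}"
    have DS: "csubspace DS" "DS \<subseteq> E" "bmap ` DS = S"
      using S csubspace_vimage bmap_vimage by (auto simp: DS_def dissipative_relation_def)
    then have "dissipative_relation (graph_on DS)"
      using S dissipative_graph_on_iff by simp
    moreover have "graph_on D \<subseteq> graph_on DS"
      using S D(2) by (auto simp: graph_on_def DS_def)
    ultimately have "graph_on DS = graph_on D"
      using max unfolding maximal_dissipative_relation_def by blast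
    then have "DS = D"
      unfolding set_eq_iff split_paired_All mem_graph_on_iff by blast
    with DS(3) show "S = bmap ` D"
      by simp
  qed
next
  assume max: "maximal_dissipative_relation (bmap ` D)"
  show "maximal_dissipative_relation (graph_on D)"
    unfolding maximal_dissipative_relation_def
  proof (intro conjI allI impI)
    show "dissipative_relation (graph_on D)"
      using max dissipative_graph_on_iff[OF D(1,2)] by (simp add: maximal_dissipative_relation_def)
    fix R assume R: "dissipative_relation R \<and> graph_on D \<subseteq> R"
    define DR where "DR = {x \<in> E. (x, t x) \<in> R}"
    have graph: "R = graph_on DR"
      unfolding DR_def using R D(3) by (intro dissipative_extension_is_graph) (auto simp: graph_on_def)
    have "D \<subseteq> DR"
      using R D(2) by (auto simp: DR_def graph_on_def)
    have DR: "DR \<subseteq> E" "csubspace DR"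
    proof -
      show "DR \<subseteq> E"
        by (auto simp: DR_def)
      have "csubspace R"
        using R by (simp add: dissipative_relation_def)
      then show "csubspace DR"
        unfolding complex_vector.subspace_def[of DR]
      proof (intro conjI ballI allI)
        note R_sub = complex_vector.subspace_0[OF \<open>csubspace R\<close>]
          complex_vector.subspace_add[OF \<open>csubspace R\<close>]
          complex_vector.subspace_scale[OF \<open>csubspace R\<close>]
        note E_sub = complex_vector.subspace_0[OF csubspace_E]
          complex_vector.subspace_add[OF csubspace_E] complex_vector.subspace_scale[OF csubspace_E]
        show "0 \<in> DR"
          using R_sub(1) E_sub(1) by (simp add: DR_def t_0 zero_prod_def)
        show "x + y \<in> DR" if "x \<in> DR" "y \<in> DR" for x y
          using that R_sub(2)[of "(x, t x)" "(y, t y)"] E_sub(2) by (simp add: DR_def t_add)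
        show "c *\<^sub>C x \<in> DR" if "x \<in> DR" for c x
          using that R_sub(3)[of "(x, t x)" c] E_sub(3) by (simp add: DR_def t_scale scaleC_prod_def)
      qed
    qed
    then have "dissipative_relation (bmap ` DR)"
      using R graph dissipative_graph_on_iff by simp
    moreover have "bmap ` D \<subseteq> bmap ` DR"
      using \<open>D \<subseteq> DR\<close> by blast
    ultimately have "bmap ` DR = bmap ` D"
      using max unfolding maximal_dissipative_relation_def by blast
    then have "DR = D"
      using domain_eq_vimage[OF D] domain_eq_vimage[OF DR(2,1)] \<open>D \<subseteq> DR\<close> D(3) by simp
    with graph show "R = graph_on D"
      by simp
  qed
qed

lemma skew_symmetric_graph_on_iff:
  assumes D: "csubspace D" "D \<subseteq> E"
  shows "skew_symmetric_relation (graph_on D) \<longleftrightarrow> skew_symmetric_relation (bmap ` D)"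
  using csubspace_graph_on[OF D] csubspace_bmap[OF D] inner_t D(2)
  by (auto simp: skew_symmetric_relation_def inner_eq_Re_cinner[symmetric] graph_on_def bmap_def subset_iff)

lemma green_triple_neg: "green_triple E (\<lambda>x. - t x) B1 (\<lambda>x. - B2 x)"
proof
  show "clinear_on E (\<lambda>x. - t x)"
    using t by (simp add: clinear_on_def)
  show "clinear_on E (\<lambda>x. - B2 x)"
    using B2 by (simp add: clinear_on_def)
  show "(\<lambda>x. (B1 x, - B2 x)) ` E = UNIV"
  proof -
    have "(a, b) \<in> (\<lambda>x. (B1 x, - B2 x)) ` E" for a b
    proof -
      obtain x where "x \<in> E" "bmap x = (a, - b)"
        by (rule bmap_onto)
      then show ?thesis
        by (intro image_eqI[of _ _ x]) (simp_all add: bmap_def)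
    qed
    then show ?thesis
      by auto
  qed
  show "cinner (- t x) y + cinner x (- t y) = cinner (B1 x) (- B2 y) + cinner (- B2 x) (B1 y)"
    if "x \<in> E" "y \<in> E" for x y
    using green[OF that] by (simp add: algebra_simps)
  fix u v assume *: "\<And>x. \<lbrakk>x \<in> E; B1 x = 0; - B2 x = 0\<rbrakk> \<Longrightarrow> cinner (- t x) u + cinner x v = 0"
  have "u \<in> E \<and> t u = - v"
  proof (rule adjoint_on_kernel)
    fix x assume "x \<in> E" "B1 x = 0" "B2 x = 0"
    with *[of x] show "cinner (t x) u + cinner x (- v) = 0"
      by simp
  qed
  then show "u \<in> E \<and> - t u = v"
    by simp
qed (rule B1)

lemma
  assumes D: "csubspace D" "D \<subseteq> E"
  shows accretive_graph_on_iff: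
      "accretive_relation (graph_on D) \<longleftrightarrow> accretive_relation (bmap ` D)"
    and maximal_accretive_graph_on_iff:
      "kernel \<subseteq> D \<Longrightarrow>
        maximal_accretive_relation (graph_on D) \<longleftrightarrow> maximal_accretive_relation (bmap ` D)"
proof -
  interpret neg: green_triple E "\<lambda>x. - t x" B1 "\<lambda>x. - B2 x"
    by (rule green_triple_neg)
  have graph: "(\<lambda>(r1, r2). (r1, - r2)) ` graph_on D = neg.graph_on D"
    by (simp add: graph_on_def neg.graph_on_def image_image)
  have trace: "(\<lambda>(r1, r2). (r1, - r2)) ` bmap ` D = neg.bmap ` D"
    by (simp add: bmap_def neg.bmap_def image_image)
  have kernel: "neg.kernel = kernel"
    by (auto simp: mem_kernel_iff neg.mem_kernel_iff)
  show "accretive_relation (graph_on D) \<longleftrightarrow> accretive_relation (bmap ` D)"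
    unfolding accretive_relation_def graph trace by (rule neg.dissipative_graph_on_iff[OF D])
  show "kernel \<subseteq> D \<Longrightarrow>
      maximal_accretive_relation (graph_on D) \<longleftrightarrow> maximal_accretive_relation (bmap ` D)"
    unfolding maximal_accretive_relation_def graph trace
    using neg.maximal_dissipative_graph_on_iff[OF D] kernel by simp
qed

end

section \<open>Boundary triplets for the adjoint\<close>

lemma adjoint_op_eq_Some_iff:
  assumes "corthogonal_complement (dom A) = {0}"
  shows "adjoint_op A y = Some z \<longleftrightarrow> (\<forall>x\<in>dom A. cinner (the (A x)) y = cinner x z)"
proof -
  have unique: "z' = z" if "\<forall>x\<in>dom A. cinner (the (A x)) y = cinner x z"
    "\<forall>x\<in>dom A. cinner (the (A x)) y = cinner x z'" for z z'
  proof -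
    have "z' - z \<in> corthogonal_complement (dom A)"
      using that by (simp add: corthogonal_complement_def cinner_diff_right)
    then show ?thesis
      using assms by simp
  qed
  have THE_eq: "(THE z. \<forall>x\<in>dom A. cinner (the (A x)) y = cinner x z) = z"
    if "\<forall>x\<in>dom A. cinner (the (A x)) y = cinner x z" for z
    by (rule the_equality) (use that unique in blast)+
  show ?thesis
    unfolding adjoint_op_def using THE_eq by (smt (verit) option.distinct(1) option.inject)
qed

text \<open>
  The difference of two candidates for a value of the adjoint is orthogonal to the domain; this makes
  the adjoint single-valued.
\<close>

lemma densely_defined_orthogonal_complement:
  assumes A: "linear_operator A" "densely_defined A"
  shows "corthogonal_complement (dom A) = {0}"
proof -
  have sub: "csubspace (dom A)"
    using A(1) by (simp add: linear_operator_def clinear_on_def)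
  have "v = 0" if "v \<in> corthogonal_complement (dom A)" for v
  proof -
    have "closure (dom A) \<subseteq> {x. inner x v = 0}"
      using that by (intro closure_minimal closed_Collect_eq continuous_intros)
        (auto simp: corthogonal_complement_eq_inner[OF sub])
    then have "v \<in> {x. inner x v = 0}"
      using A(2) by (simp only: densely_defined_def) blast
    then have "inner v v = 0"
      by simp
    then show ?thesis
      by simp
  qed
  then show ?thesis
    by (auto simp: corthogonal_complement_def)
qed

lemma skew_symmetric_relation_polar:
  assumes R: "skew_symmetric_relation R" and "(x, y) \<in> R" "(u, v) \<in> R"
  shows "cinner u y + cinner v x = 0"
  using assms by (intro dissipative_relation_neutral_orthogonal[of R])
    (auto simp: skew_symmetric_relation_def dissipative_relation_def)

text \<open>
  Skew-symmetry puts \<open>A\<^sub>0\<close> inside \<open>- A\<^sub>0\<^sup>*\<close>.  Then Green's identity, tested with an element whose boundary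
  values are those of \<open>x \<in> dom A\<^sub>0\<close> exchanged, gives \<open>\<parallel>B1 x\<parallel>\<^sup>2 + \<parallel>B2 x\<parallel>\<^sup>2 = 0\<close>.  So the domain of \<open>A\<^sub>0\<close> lies
  in the joint kernel of the boundary maps, and the adjoint relation for the latter implies the one for
  \<open>A\<^sub>0\<close>.
\<close>

lemma boundary_triplet_green_triple:
  fixes A0 :: "'x::chilbert_space \<rightharpoonup> 'x" and B1 B2 :: "'x \<Rightarrow> 'b::chilbert_space"
  assumes A0: "linear_operator A0" "densely_defined A0" "skew_symmetric_op A0"
    and triplet: "boundary_triplet A0 B1 B2"
  shows "green_triple (dom (adjoint_op A0)) (\<lambda>x. the (adjoint_op A0 x)) B1 B2"
proof -
  define T where "T = adjoint_op A0"
  define t where "t = (\<lambda>x. the (T x))"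
  have T_iff: "T y = Some z \<longleftrightarrow> (\<forall>x\<in>dom A0. cinner (the (A0 x)) y = cinner x z)" for y z
    unfolding T_def
    by (rule adjoint_op_eq_Some_iff[OF densely_defined_orthogonal_complement[OF A0(1,2)]])
  have T_dom: "cinner (the (A0 x)) y = cinner x (t y)" if "x \<in> dom A0" "y \<in> dom T" for x y
    using T_iff[of y "t y"] that by (auto simp: t_def)
  have lin: "clinear_on (dom T) B1" "clinear_on (dom T) B2"
    and surj: "(\<lambda>x. (B1 x, B2 x)) ` dom T = UNIV"
    and green: "\<And>x y. \<lbrakk>x \<in> dom T; y \<in> dom T\<rbrakk> \<Longrightarrow>
      cinner (t x) y + cinner x (t y) = cinner (B1 x) (B2 y) + cinner (B2 x) (B1 y)"
    using triplet by (simp_all add: boundary_triplet_def T_def t_def Let_def)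
  have "csubspace (dom T)"
    using lin(1) by (simp add: clinear_on_def)
  have t_lin: "clinear_on (dom T) t"
    unfolding clinear_on_def
  proof (intro conjI ballI allI \<open>csubspace (dom T)\<close>)
    show "t (x + y) = t x + t y" if "x \<in> dom T" "y \<in> dom T" for x y
    proof -
      have "T (x + y) = Some (t x + t y)"
        unfolding T_iff using that T_dom by (simp add: cinner_add_right)
      then show ?thesis
        by (simp add: t_def)
    qed
    show "t (c *\<^sub>C x) = c *\<^sub>C t x" if "x \<in> dom T" for c x
    proof -
      have "T (c *\<^sub>C x) = Some (c *\<^sub>C t x)"
        unfolding T_iff using that T_dom by (simp add: cinner_scaleC_right)
      then show ?thesis
        by (simp add: t_def)
    qed
  qed
  have A0_T: "T x = Some (- the (A0 x))" if "x \<in> dom A0" for x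
    unfolding T_iff
  proof
    fix y assume "y \<in> dom A0"
    then have "cinner y (the (A0 x)) + cinner (the (A0 y)) x = 0"
      using that A0(3) unfolding skew_symmetric_op_def
      by (intro skew_symmetric_relation_polar) (auto intro: in_graphI)
    then show "cinner (the (A0 y)) x = cinner y (- the (A0 x))"
      by (simp add: eq_neg_iff_add_eq_0 add.commute)
  qed
  have A0_kernel: "B1 x = 0 \<and> B2 x = 0" if x: "x \<in> dom A0" for x
  proof -
    have "x \<in> dom T" "t x = - the (A0 x)"
      using A0_T[OF x] by (auto simp: t_def)
    obtain y where y: "y \<in> dom T" "B1 y = B2 x" "B2 y = B1 x"
    proof -
      have "(B2 x, B1 x) \<in> (\<lambda>x. (B1 x, B2 x)) ` dom T"
        unfolding surj by (rule UNIV_I)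
      then obtain y where "y \<in> dom T" "(B2 x, B1 x) = (B1 y, B2 y)"
        by blast
      then show thesis
        using that[of y] by simp
    qed
    have "cinner (B1 x) (B1 x) + cinner (B2 x) (B2 x) = 0"
      using green[OF \<open>x \<in> dom T\<close> y(1)] T_dom[OF x y(1)] \<open>t x = _\<close> y(2,3) by simp
    then have "(norm (B1 x))\<^sup>2 + (norm (B2 x))\<^sup>2 = 0"
      unfolding cinner_self by (metis of_real_add of_real_eq_0_iff)
    then show ?thesis
      by (simp add: add_nonneg_eq_0_iff)
  qed
  have "green_triple (dom T) t B1 B2"
  proof (unfold_locales, fact t_lin, fact lin(1), fact lin(2), fact surj, fact green)
    fix u v
    assume *: "\<And>x. \<lbrakk>x \<in> dom T; B1 x = 0; B2 x = 0\<rbrakk> \<Longrightarrow> cinner (t x) u + cinner x v = 0"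
    have "T u = Some v"
      unfolding T_iff
    proof
      fix x assume x: "x \<in> dom A0"
      then have "cinner (- the (A0 x)) u + cinner x v = 0"
        using *[of x] A0_kernel A0_T by (auto simp: t_def)
      then show "cinner (the (A0 x)) u = cinner x v"
        by simp
    qed
    then show "u \<in> dom T \<and> t u = v"
      by (auto simp: t_def)
  qed
  then show ?thesis
    by (simp add: T_def t_def)
qed

section \<open>The graph topology\<close>

lemma graph_restrict: "D \<subseteq> dom T \<Longrightarrow> Map.graph (T |` D) = (\<lambda>x. (x, the (T x))) ` D"
  unfolding Map.graph_eq_to_snd_dom by (auto simp: image_iff)

text \<open>
  The map \<open>x \<mapsto> (x, T x)\<close> is an isometry from the domain with the graph norm into the product space.
\<close>

lemma mem_graph_topology_closure_iff:
  fixes T :: "'x::complex_inner \<rightharpoonup> 'x"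
  assumes T: "linear_operator T" and D: "D \<subseteq> dom T"
  shows "x \<in> graph_topology T closure_of D \<longleftrightarrow>
    x \<in> dom T \<and> (x, the (T x)) \<in> closure (Map.graph (T |` D))"
proof -
  let ?g = "\<lambda>x. (x, the (T x))"
  have sub: "csubspace (dom T)"
    and add: "\<And>x y. \<lbrakk>x \<in> dom T; y \<in> dom T\<rbrakk> \<Longrightarrow> the (T (x + y)) = the (T x) + the (T y)"
    and scale: "\<And>c x. x \<in> dom T \<Longrightarrow> the (T (c *\<^sub>C x)) = c *\<^sub>C the (T x)"
    using T by (auto simp: linear_operator_def clinear_on_def)
  have norm_eq: "graph_norm T (x - y) = dist (?g x) (?g y)" if "x \<in> dom T" "y \<in> dom T" for x y
  proof -
    have "the (T (x - y)) = the (T x) - the (T y)"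
      using add[of "x - y" y] complex_vector.subspace_diff[OF sub that] that(2) by simp
    then show ?thesis
      by (simp add: graph_norm_def dist_norm)
  qed
  \<comment> \<open>A metric must be symmetric off its carrier too; there both values of \<open>T\<close> are \<open>the None\<close>.\<close>
  have norm_minus: "graph_norm T (- z) = graph_norm T z" for z
  proof (cases "z \<in> dom T")
    case True
    have "- z = (-1) *\<^sub>C z"
      by (simp add: complex_vector.scale_minus_left scaleC_one)
    then have "the (T (- z)) = - the (T z)"
      using scale[OF True, of "-1"] by (simp add: complex_vector.scale_minus_left scaleC_one)
    then show ?thesis
      by (simp add: graph_norm_def norm_Pair)
  next
    case False
    then have "- z \<notin> dom T"
      using complex_vector.subspace_neg[OF sub, of "- z"] by auto
    with False have "T (- z) = None" "T z = None"
      by (auto simp: domIff)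
    then show ?thesis
      by (simp add: graph_norm_def norm_Pair)
  qed
  interpret M: Metric_space "dom T" "\<lambda>x y. graph_norm T (x - y)"
  proof
    show "0 \<le> graph_norm T (x - y)" for x y
      by (simp add: graph_norm_def)
    show "graph_norm T (x - y) = graph_norm T (y - x)" for x y
      using norm_minus[of "x - y"] by simp
    show "graph_norm T (x - y) = 0 \<longleftrightarrow> x = y" if "x \<in> dom T" "y \<in> dom T" for x y
      using norm_eq[OF that] by auto
    show "graph_norm T (x - z) \<le> graph_norm T (x - y) + graph_norm T (y - z)"
      if "x \<in> dom T" "y \<in> dom T" "z \<in> dom T" for x y z
      unfolding norm_eq[OF that(1,2)] norm_eq[OF that(2,3)] norm_eq[OF that(1,3)]
      by (rule dist_triangle)
  qed
  have "x \<in> graph_topology T closure_of D \<longleftrightarrow>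
      x \<in> dom T \<and> (\<forall>r>0. \<exists>y\<in>D. y \<in> dom T \<and> graph_norm T (x - y) < r)"
    by (auto simp: graph_topology_def M.metric_closure_of)
  also have "\<dots> \<longleftrightarrow> x \<in> dom T \<and> (\<forall>r>0. \<exists>y\<in>D. dist (?g y) (?g x) < r)"
    using D norm_eq by (metis (no_types, lifting) dist_commute subsetD)
  also have "\<dots> \<longleftrightarrow> x \<in> dom T \<and> ?g x \<in> closure (Map.graph (T |` D))"
    unfolding graph_restrict[OF D] closure_approachable by simp
  finally show ?thesis .
qed

section \<open>Restrictions described by boundary values\<close>

lemma partial_map_eqI: "(\<And>y z. f y = Some z \<longleftrightarrow> g y = Some z) \<Longrightarrow> f = g"
  by (metis ext option.exhaust)

theorem theorem2p2:
  fixes A0 A :: "'x::chilbert_space \<rightharpoonup> 'x"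
    and B1 B2 :: "'x \<Rightarrow> 'b::chilbert_space"
    and D :: "'x set" and C :: "('b \<times> 'b) set"
  assumes A0: "linear_operator A0" "densely_defined A0" "skew_symmetric_op A0" "closed_operator A0"
    and triplet: "boundary_triplet A0 B1 B2"
    and D: "csubspace D" "D \<subseteq> dom (adjoint_op A0)"
    and ker_le_D: "{x \<in> dom (adjoint_op A0). B1 x = 0} \<inter> {x \<in> dom (adjoint_op A0). B2 x = 0} \<subseteq> D"
    and A_def: "A = adjoint_op A0 |` D"
    and C_def: "C = (\<lambda>d. (B1 d, B2 d)) ` D"
  shows
    \<comment> \<open>1\<close>
    "(dom A = D \<and> D = {d \<in> dom (adjoint_op A0). (B1 d, B2 d) \<in> C})
     \<and> \<comment> \<open>2\<close>
     (let D_tilde = {d \<in> dom (adjoint_op A0). (B1 d, B2 d) \<in> closure C} in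
        operator_closure_is A (adjoint_op A0 |` D_tilde) \<and>
        D_tilde = graph_topology (adjoint_op A0) closure_of D \<and>
        (closed_operator A \<longleftrightarrow> closed C))
     \<and> \<comment> \<open>3\<close>
     adjoint_op A = uminus_op (adjoint_op A0) |`
       {d \<in> dom (adjoint_op A0). (B1 d, B2 d) \<in> prod.swap ` corthogonal_complement C}
     \<and> \<comment> \<open>4\<close>
     (dissipative_op A \<longleftrightarrow> dissipative_relation C)
     \<and> (maximal_dissipative_op A \<longleftrightarrow> maximal_dissipative_relation C)
     \<and> (maximal_dissipative_op A \<longleftrightarrow> (\<exists>V. contraction V \<and> C = ker_row V))
     \<and> \<comment> \<open>5\<close>
     (skew_adjoint_op A \<longleftrightarrow> C = prod.swap ` corthogonal_complement C)
     \<and> (skew_adjoint_op A \<longleftrightarrow> (\<exists>V. unitary V \<and> C = ker_row V))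
     \<and> \<comment> \<open>accretive and skew-symmetric\<close>
     (accretive_op A \<longleftrightarrow> accretive_relation C)
     \<and> (maximal_accretive_op A \<longleftrightarrow> maximal_accretive_relation C)
     \<and> (skew_symmetric_op A \<longleftrightarrow> skew_symmetric_relation C)"
proof -
  define T where "T = adjoint_op A0"
  interpret G: green_triple "dom T" "\<lambda>x. the (T x)" B1 B2
    unfolding T_def using A0(1-3) triplet by (rule boundary_triplet_green_triple)
  have D': "csubspace D" "D \<subseteq> dom T" "G.kernel \<subseteq> D"
    using D ker_le_D unfolding T_def[symmetric] by (auto simp: G.mem_kernel_iff)
  have C: "G.bmap ` D = C"
    by (simp add: C_def G.bmap_def)
  have A: "A = T |` D"
    by (simp add: A_def T_def)
  have dom_A: "dom A = D"
    using D'(2) by (auto simp: A)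
  have graph: "Map.graph (T |` S) = G.graph_on S" if "S \<subseteq> dom T" for S
    using graph_restrict[OF that] by (simp add: G.graph_on_def)
  have graph_A: "Map.graph A = G.graph_on D"
    using graph[OF D'(2)] by (simp add: A)
  have vimage: "{d \<in> dom T. (B1 d, B2 d) \<in> S} = {d \<in> dom T. G.bmap d \<in> S}" for S
    by (simp add: G.bmap_def)

  have part1: "D = {d \<in> dom T. (B1 d, B2 d) \<in> C}"
    using G.domain_eq_vimage[OF D'] by (simp add: C vimage)

  define D_tilde where "D_tilde = {d \<in> dom T. (B1 d, B2 d) \<in> closure C}"
  have closure_graph: "closure (Map.graph A) = Map.graph (T |` D_tilde)"
    using G.closure_graph_on[OF D'] graph[of D_tilde] by (auto simp: graph_A C vimage D_tilde_def)
  have "x \<in> graph_topology T closure_of D \<longleftrightarrow> x \<in> D_tilde" for x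
  proof -
    have "linear_operator T"
      using G.t by (simp add: linear_operator_def)
    then have "x \<in> graph_topology T closure_of D \<longleftrightarrow>
        x \<in> dom T \<and> (x, the (T x)) \<in> closure (Map.graph A)"
      unfolding A by (rule mem_graph_topology_closure_iff[OF _ D'(2)])
    also have "\<dots> \<longleftrightarrow> x \<in> D_tilde"
      using graph[of D_tilde] by (auto simp: closure_graph G.mem_graph_on_iff D_tilde_def)
    finally show ?thesis .
  qed
  then have part2: "operator_closure_is A (T |` D_tilde)" "D_tilde = graph_topology T closure_of D"
      "closed_operator A \<longleftrightarrow> closed C"
    using closure_graph G.closed_graph_on_iff[OF D']
    by (auto simp: operator_closure_is_def closed_operator_def graph_A C)

  let ?C' = "prod.swap ` corthogonal_complement C"
  define D'' where "D'' = {d \<in> dom T. (B1 d, B2 d) \<in> ?C'}"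
  have part3: "adjoint_op A = uminus_op T |` D''"
  proof (rule partial_map_eqI)
    fix y z
    have "adjoint_op A y = Some z \<longleftrightarrow> (\<forall>x\<in>D. cinner (the (T x)) y = cinner x z)"
      using adjoint_op_eq_Some_iff[of A y z] G.orthogonal_complement_domain[OF D'(2,3)]
      unfolding dom_A by (simp add: A)
    also have "\<dots> \<longleftrightarrow> (- z, y) \<in> corthogonal_complement (G.graph_on D)"
      by (auto simp: corthogonal_complement_def G.graph_on_def cinner_prod_def)
    also have "\<dots> \<longleftrightarrow> y \<in> dom T \<and> the (T y) = - z \<and> prod.swap (G.bmap y) \<in> corthogonal_complement C"
      unfolding G.mem_orthogonal_graph_iff[OF D'(2,3)] C ..
    also have "prod.swap (G.bmap y) \<in> corthogonal_complement C \<longleftrightarrow> (B1 y, B2 y) \<in> ?C'"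
      by (force simp: G.bmap_def)
    also have "y \<in> dom T \<and> the (T y) = - z \<and> (B1 y, B2 y) \<in> ?C' \<longleftrightarrow> (uminus_op T |` D'') y = Some z"
      by (auto simp: restrict_map_def uminus_op_def D''_def)
    finally show "adjoint_op A y = Some z \<longleftrightarrow> (uminus_op T |` D'') y = Some z" .
  qed

  have part4: "dissipative_op A \<longleftrightarrow> dissipative_relation C"
      "maximal_dissipative_op A \<longleftrightarrow> maximal_dissipative_relation C"
    using G.dissipative_graph_on_iff[OF D'(1,2)] G.maximal_dissipative_graph_on_iff[OF D']
    by (simp_all add: dissipative_op_def maximal_dissipative_op_def graph_A C)
  have contraction: "maximal_dissipative_relation C \<longleftrightarrow> (\<exists>V. contraction V \<and> C = ker_row V)"
    using maximal_dissipative_imp_ker_row ker_row_maximal_dissipative by blast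

  have part5: "skew_adjoint_op A \<longleftrightarrow> C = ?C'"
  proof -
    have "uminus_op A = uminus_op T |` D"
      by (auto simp: A uminus_op_def restrict_map_def)
    then have "skew_adjoint_op A \<longleftrightarrow> uminus_op T |` D'' = uminus_op T |` D"
      by (simp add: skew_adjoint_op_def part3)
    also have "\<dots> \<longleftrightarrow> D'' = D"
    proof
      assume "uminus_op T |` D'' = uminus_op T |` D"
      then have "dom (uminus_op T |` D'') = dom (uminus_op T |` D)"
        by simp
      moreover have "dom (uminus_op T) = dom T"
        by (auto simp: uminus_op_def dom_def)
      ultimately show "D'' = D"
        using D'(2) by (auto simp: D''_def)
    qed simp
    also have "\<dots> \<longleftrightarrow> ?C' = C"
    proof
      assume "D'' = D"
      then show "?C' = C"
        using G.bmap_vimage[of ?C'] C unfolding D''_def vimage by simp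
    next
      assume "?C' = C"
      then show "D'' = D"
        using part1 by (simp add: D''_def)
    qed
    finally show ?thesis
      by auto
  qed

  have accretive: "accretive_op A \<longleftrightarrow> accretive_relation C"
      "maximal_accretive_op A \<longleftrightarrow> maximal_accretive_relation C"
      "skew_symmetric_op A \<longleftrightarrow> skew_symmetric_relation C"
    using G.accretive_graph_on_iff[OF D'(1,2)] G.maximal_accretive_graph_on_iff[OF D']
      G.skew_symmetric_graph_on_iff[OF D'(1,2)]
    by (simp_all add: accretive_op_def maximal_accretive_op_def skew_symmetric_op_def graph_A C)

  show ?thesis
    unfolding Let_def T_def[symmetric] D_tilde_def[symmetric] D''_def[symmetric]
    using dom_A part1 part2 part3 part4 contraction part5 self_swap_complement_iff_unitary[of C] accretive
    by blast
qed

end
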